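(* Let $k\ge3$ and consider the group $G=\mathbb Z/k\mathbb Z\star\mathbb Z/k\mathbb Z$, the generators of the two cyclic groups being respectively $a$ and $b$. Consider the simple random walk $(G,\mu)$ with $\mu(a)=\mu(a^{-1})=\mu(b)=\mu(b^{-1})=1/4$. Let $F_n:[0,1]\to\mathbb R$, $n\in\mathbb N$, be defined by $$F_0(x)=1,\quad F_1(x)=x,\quad F_n(x)=2(2-x)F_{n-1}(x)-F_{n-2}(x)\ \ (n\ge2),$$ and let $x_k$ be the unique solution in $(0,1)$ of the equation $F_k(x)=1$. Then the harmonic measure of $(G,\mu)$ is stationary and ergodic with respect to the shift on $\Sigma^{\mathbb N}$, and is the Markovian multiplicative measure associated with the vector $r$ given by $$r(a^i)=r(b^i)=\tfrac12F_i(x_k),\qquad i\in\{1,\dots,k-1\}$$ (and $F_i(x_k)=F_{k-i}(x_k)$ for $1\le i\le k-1$). The drift is $\gamma_k=(1-x_k)/2$. It is a strictly increasing function of $k$, and $\lim_{k\to\infty}\gamma_k=1/3$.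
   Context: $\Sigma=\Sigma_1\sqcup\Sigma_2$ with $\Sigma_1=\{a,\dots,a^{k-1}\}$, $\Sigma_2=\{b,\dots,b^{k-1}\}$; $\Sigma_u$ is the $\Sigma_i$ containing $u$. Elements of $G$ are identified with the set $L$ of finite words over $\Sigma$ with consecutive letters in different $\Sigma_i$'s (empty word $=1$); $|g|$ is the number of letters of $g$, i.e. the word length with respect to $\Sigma$ (not with respect to $\{a^{\pm1},b^{\pm1}\}$). Random walk: $X_0=1$, $X_{n+1}=X_n\ast x_n$ with $(x_n)$ i.i.d. of law $\mu$. The drift is the a.s. constant limit $\lim_n|X_n|/n$. The harmonic measure is the law, as a measure on $\Sigma^{\mathbb N}$, of the a.s. limit $X_\infty$ of $X_n$, an infinite word with alternating factors (the common prefix length of $X_n$ and $X_\infty$ tends to infinity). The shift is $(x_n)_n\mapsto(x_{n+1})_n$. For $r\in\mathbb R^\Sigma$ with positive entries summing to $1$, and $r(S)=\sum_{u\in S}r(u)$, the Markovian multiplicative measure associated with $r$ gives to the cylinder $u_1\cdots u_m\Sigma^{\mathbb N}$ (for nonempty $u_1\cdots u_m\in L$) the mass $\frac{r(u_1)}{r(\Sigma\setminus\Sigma_{u_1})}\cdots\frac{r(u_{m-1})}{r(\Sigma\setminus\Sigma_{u_{m-1}})}r(u_m)$. (It is part of the paper that $F_k(x)=1$ has exactly one solution in $(0,1)$.) *)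

theory Defs
  imports "HOL-Algebra.Group" "HOL-Probability.Probability"
begin

text \<open>
  The group \<open>\<int>/k\<int> \<star> \<int>/k\<int>\<close> in normal form. The letter \<open>a\<^sup>i\<close> is encoded as \<open>(FacA, i)\<close> and
  \<open>b\<^sup>i\<close> as \<open>(FacB, i)\<close>, with \<open>1 \<le> i < k\<close>. Group elements are the words in which consecutive
  letters lie in different factors.
\<close>

datatype factor = FacA | FacB

type_synonym letter = "factor \<times> nat"

definition letters_of :: "nat \<Rightarrow> factor \<Rightarrow> letter set" where
  "letters_of k f = {f} \<times> {1..<k}"

definition letters :: "nat \<Rightarrow> letter set" where
  "letters k = letters_of k FacA \<union> letters_of k FacB"

definition reduced_words :: "nat \<Rightarrow> letter list set" where
  "reduced_words k = {w \<in> lists (letters k). successively (\<lambda>u v. fst u \<noteq> fst v) w}"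

text \<open>
  Left multiplication of a reduced word by one letter; \<open>foldr\<close> extends it to words.
\<close>

fun letter_mult :: "nat \<Rightarrow> letter \<Rightarrow> letter list \<Rightarrow> letter list" where
  "letter_mult k u [] = [u]"
| "letter_mult k u (v # w) =
     (if fst u \<noteq> fst v then u # v # w
      else if (snd u + snd v) mod k = 0 then w
      else (fst u, (snd u + snd v) mod k) # w)"

definition word_mult :: "nat \<Rightarrow> letter list \<Rightarrow> letter list \<Rightarrow> letter list" where
  "word_mult k g h = foldr (letter_mult k) g h"

definition free_product :: "nat \<Rightarrow> letter list monoid" where
  "free_product k = \<lparr>carrier = reduced_words k, monoid.mult = word_mult k, one = []\<rparr>"

definition gen_a :: "letter list" where "gen_a = [(FacA, 1)]"
definition gen_b :: "letter list" where "gen_b = [(FacB, 1)]"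

definition simple_step :: "nat \<Rightarrow> letter list pmf" where
  "simple_step k =
     pmf_of_set {gen_a, inv\<^bsub>free_product k\<^esub> gen_a, gen_b, inv\<^bsub>free_product k\<^esub> gen_b}"


text \<open>
  The random walk on its canonical space: the coordinates of
  \<open>stream_space (measure_pmf \<mu>)\<close> are i.i.d. of law \<open>\<mu>\<close>.
\<close>

definition step_space :: "letter list pmf \<Rightarrow> letter list stream measure" where
  "step_space \<mu> = stream_space (measure_pmf \<mu>)"

primrec walk :: "nat \<Rightarrow> letter list stream \<Rightarrow> nat \<Rightarrow> letter list" where
  "walk k \<omega> 0 = \<one>\<^bsub>free_product k\<^esub>"
| "walk k \<omega> (Suc n) = walk k \<omega> n \<otimes>\<^bsub>free_product k\<^esub> (\<omega> !! n)"

definition has_drift :: "nat \<Rightarrow> letter list pmf \<Rightarrow> real \<Rightarrow> bool" where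
  "has_drift k \<mu> \<gamma> \<longleftrightarrow>
     (AE \<omega> in step_space \<mu>. (\<lambda>n. real (length (walk k \<omega> n)) / real n) \<longlonglongrightarrow> \<gamma>)"

definition drift :: "nat \<Rightarrow> letter list pmf \<Rightarrow> real" where
  "drift k \<mu> = (THE \<gamma>. has_drift k \<mu> \<gamma>)"

definition word_space :: "nat \<Rightarrow> letter stream measure" where
  "word_space k = stream_space (count_space (letters k))"

definition alternating :: "letter stream \<Rightarrow> bool" where
  "alternating \<xi> \<longleftrightarrow> (\<forall>n. fst (\<xi> !! n) \<noteq> fst (\<xi> !! Suc n))"

definition common_prefix_length :: "letter list \<Rightarrow> letter stream \<Rightarrow> nat" where
  "common_prefix_length w \<xi> = Max {m. m \<le> length w \<and> take m w = stake m \<xi>}"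

definition converges_to_end :: "(nat \<Rightarrow> letter list) \<Rightarrow> letter stream \<Rightarrow> bool" where
  "converges_to_end w \<xi> \<longleftrightarrow>
     filterlim (\<lambda>n. common_prefix_length (w n) \<xi>) at_top sequentially"

definition is_harmonic_measure :: "nat \<Rightarrow> letter list pmf \<Rightarrow> letter stream measure \<Rightarrow> bool" where
  "is_harmonic_measure k \<mu> \<nu> \<longleftrightarrow>
     (\<exists>X_inf \<in> measurable (step_space \<mu>) (word_space k).
        (AE \<omega> in step_space \<mu>. alternating (X_inf \<omega>) \<and> converges_to_end (walk k \<omega>) (X_inf \<omega>)) \<and>
        \<nu> = distr (step_space \<mu>) (word_space k) X_inf)"

definition harmonic_measure :: "nat \<Rightarrow> letter list pmf \<Rightarrow> letter stream measure" where
  "harmonic_measure k \<mu> = (THE \<nu>. is_harmonic_measure k \<mu> \<nu>)"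


definition shift_stationary :: "letter stream measure \<Rightarrow> bool" where
  "shift_stationary \<nu> \<longleftrightarrow> stl \<in> measurable \<nu> \<nu> \<and> distr \<nu> \<nu> stl = \<nu>"

definition shift_ergodic :: "letter stream measure \<Rightarrow> bool" where
  "shift_ergodic \<nu> \<longleftrightarrow>
     (\<forall>E \<in> sets \<nu>. stl -` E \<inter> space \<nu> = E \<longrightarrow> measure \<nu> E = 0 \<or> measure \<nu> E = 1)"

definition multiplicative_weight :: "nat \<Rightarrow> (letter \<Rightarrow> real) \<Rightarrow> letter list \<Rightarrow> real" where
  "multiplicative_weight k r u =
     (\<Prod>i<length u - 1. r (u ! i) / sum r (letters k - letters_of k (fst (u ! i)))) * r (last u)"

text \<open>
  \<open>sstart (letters k) u\<close> is the cylinder of the infinite words starting with \<open>u\<close>. The values on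
  reduced words determine the measure: those of a given length already have total mass one.
\<close>

definition is_markovian_multiplicative ::
    "nat \<Rightarrow> (letter \<Rightarrow> real) \<Rightarrow> letter stream measure \<Rightarrow> bool" where
  "is_markovian_multiplicative k r \<nu> \<longleftrightarrow>
     (\<forall>u \<in> letters k. 0 < r u) \<and> sum r (letters k) = 1 \<and>
     prob_space \<nu> \<and> sets \<nu> = sets (word_space k) \<and>
     (\<forall>u \<in> reduced_words k. u \<noteq> [] \<longrightarrow>
        measure \<nu> (sstart (letters k) u) = multiplicative_weight k r u)"


fun F :: "nat \<Rightarrow> real \<Rightarrow> real" where
  "F 0 x = 1"
| "F (Suc 0) x = x"
| "F (Suc (Suc n)) x = 2 * (2 - x) * F (Suc n) x - F n x"

definition root_F :: "nat \<Rightarrow> real" where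
  "root_F k = (THE x. x \<in> {0<..<1} \<and> F k x = 1)"


subsection \<open>The group structure\<close>

lemma letters_iff: "u \<in> letters k \<longleftrightarrow> 0 < snd u \<and> snd u < k"
  by (cases u; cases "fst u") (auto simp: letters_def letters_of_def)

lemma reduced_words_Nil [simp]: "[] \<in> reduced_words k"
  by (simp add: reduced_words_def)

lemma reduced_words_Cons:
  "u # w \<in> reduced_words k \<longleftrightarrow>
     u \<in> letters k \<and> w \<in> reduced_words k \<and> (w = [] \<or> fst u \<noteq> fst (hd w))"
  by (auto simp: reduced_words_def successively_Cons)

lemma letter_mult_closed:
  assumes "u \<in> letters k" "w \<in> reduced_words k"
  shows "letter_mult k u w \<in> reduced_words k"
proof (cases w)
  case (Cons v w')
  then show ?thesis
    using assms by (auto simp: reduced_words_Cons letters_iff)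
qed (use assms in \<open>simp add: reduced_words_Cons\<close>)

lemma word_mult_closed:
  assumes "g \<in> reduced_words k" "h \<in> reduced_words k"
  shows "word_mult k g h \<in> reduced_words k"
  using assms(1)
  by (induction g)
     (auto simp: word_mult_def reduced_words_Cons assms(2) intro: letter_mult_closed)

lemma letter_mult_same:
  assumes "(f, p) \<in> letters k" "(f, q) \<in> letters k" "w \<in> reduced_words k"
  shows "letter_mult k (f, p) (letter_mult k (f, q) w) =
    (if (p + q) mod k = 0 then w else letter_mult k (f, (p + q) mod k) w)"
proof -
  have pq: "0 < p" "p < k" "0 < q" "q < k"
    using assms by (auto simp: letters_iff)
  have unreduced: "letter_mult k (f, p) (letter_mult k (f, q) w) =
    (if (p + q) mod k = 0 then w else letter_mult k (f, (p + q) mod k) w)"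
    if "w = [] \<or> fst (hd w) \<noteq> f"
    using that by (cases w) auto
  show ?thesis
  proof (cases "w = [] \<or> fst (hd w) \<noteq> f")
    case False
    then obtain s w' where w: "w = (f, s) # w'"
      by (cases w) auto
    have s: "0 < s" "s < k" and w': "w' \<in> reduced_words k" "w' = [] \<or> fst (hd w') \<noteq> f"
      using assms(3) by (auto simp: w reduced_words_Cons letters_iff)
    have assoc: "(p + (q + s) mod k) mod k = (p + q + s) mod k"
      "((p + q) mod k + s) mod k = (p + q + s) mod k"
      by (simp_all add: mod_simps ac_simps)
    have sk: "s mod k = s" and pk: "p mod k = p"
      using s pq by auto
    show ?thesis
    proof (cases "(q + s) mod k = 0")
      case True
      then have "(p + q + s) mod k = p"
        using assoc(1) pk by simp
      moreover have "(p + q) mod k = 0 \<Longrightarrow> p = s"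
        using assoc(2) sk \<open>(p + q + s) mod k = p\<close> by simp
      ultimately show ?thesis
        using True w w'(2) assoc pq by (cases w') auto
    next
      case False
      have "(p + q) mod k = 0 \<Longrightarrow> (p + q + s) mod k = s"
        using assoc(2) sk by simp
      then show ?thesis
        using False w assoc s by auto
    qed
  qed (rule unreduced)
qed

lemma word_mult_letter_mult:
  assumes "u \<in> letters k" "w \<in> reduced_words k" "h \<in> reduced_words k"
  shows "word_mult k (letter_mult k u w) h = letter_mult k u (word_mult k w h)"
proof (cases w)
  case (Cons v w')
  obtain f p where u: "u = (f, p)" by force
  obtain f' q where v: "v = (f', q)" by force
  have "word_mult k w' h \<in> reduced_words k"
    using assms by (intro word_mult_closed) (auto simp: Cons reduced_words_Cons)
  then show ?thesis
    using assms letter_mult_same[of f p k q "word_mult k w' h"]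
    by (auto simp: Cons u v word_mult_def reduced_words_Cons)
qed (simp add: word_mult_def)

lemma word_mult_assoc:
  assumes "g \<in> reduced_words k" "h \<in> reduced_words k" "w \<in> reduced_words k"
  shows "word_mult k (word_mult k g h) w = word_mult k g (word_mult k h w)"
  using assms(1)
proof (induction g)
  case (Cons u g)
  have "word_mult k (word_mult k (u # g) h) w = word_mult k (letter_mult k u (word_mult k g h)) w"
    by (simp add: word_mult_def)
  also have "\<dots> = letter_mult k u (word_mult k (word_mult k g h) w)"
    using Cons.prems assms by (intro word_mult_letter_mult word_mult_closed) (auto simp: reduced_words_Cons)
  also have "\<dots> = letter_mult k u (word_mult k g (word_mult k h w))"
    using Cons by (simp add: reduced_words_Cons)
  finally show ?case by (simp add: word_mult_def)
qed (simp add: word_mult_def)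

lemma word_mult_Nil_right:
  "g \<in> reduced_words k \<Longrightarrow> word_mult k g [] = g"
proof (induction g)
  case (Cons u g)
  then show ?case by (cases g) (auto simp: word_mult_def reduced_words_Cons)
qed (simp add: word_mult_def)

lemma word_left_inverse:
  "g \<in> reduced_words k \<Longrightarrow> \<exists>h \<in> reduced_words k. word_mult k h g = []"
proof (induction g)
  case Nil
  then show ?case by (intro bexI[of _ "[]"]) (auto simp: word_mult_def)
next
  case (Cons u g)
  then obtain h where h: "h \<in> reduced_words k" "word_mult k h g = []"
    by (auto simp: reduced_words_Cons)
  let ?v = "[(fst u, k - snd u)]"
  have u: "0 < snd u" "snd u < k"
    using Cons.prems by (auto simp: reduced_words_Cons letters_iff)
  then have v: "?v \<in> reduced_words k"
    by (auto simp: reduced_words_Cons letters_iff)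
  have "word_mult k ?v (u # g) = g"
    using u by (simp add: word_mult_def)
  then have "word_mult k (word_mult k h ?v) (u # g) = []"
    using h v Cons.prems by (simp add: word_mult_assoc)
  then show ?case
    using word_mult_closed[OF h(1) v] by blast
qed

lemma group_free_product: "group (free_product k)"
  by (rule groupI)
     (auto simp: free_product_def word_mult_closed word_mult_assoc word_left_inverse,
      simp add: word_mult_def)

lemma gen_pow:
  assumes "i < k"
  shows "[(f, 1)] [^]\<^bsub>free_product k\<^esub> i = (if i = 0 then [] else [(f, i)])"
  using assms
proof (induction i)
  case (Suc i)
  then show ?case by (auto simp: free_product_def word_mult_def)
qed (simp add: free_product_def)

lemma gen_pow_k:
  assumes "2 \<le> k"
  shows "[(f, 1)] [^]\<^bsub>free_product k\<^esub> k = \<one>\<^bsub>free_product k\<^esub>"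
proof -
  obtain i where i: "k = Suc i" "0 < i"
    using assms by (cases k) auto
  have "[(f, 1)] [^]\<^bsub>free_product k\<^esub> i = [(f, i)]"
    using gen_pow[of i k f] i by simp
  then show ?thesis
    using i by (simp add: free_product_def word_mult_def)
qed

lemma inv_gen:
  assumes "2 \<le> k"
  shows "inv\<^bsub>free_product k\<^esub> [(f, 1)] = [(f, k - 1)]"
proof -
  interpret group "free_product k" by (rule group_free_product)
  show ?thesis
    by (rule inv_equality)
       (use assms in \<open>auto simp: free_product_def word_mult_def reduced_words_Cons letters_iff\<close>)
qed

lemma pmf_simple_step:
  assumes "3 \<le> k" "s \<in> {gen_a, inv\<^bsub>free_product k\<^esub> gen_a, gen_b, inv\<^bsub>free_product k\<^esub> gen_b}"
  shows "pmf (simple_step k) s = 1 / 4"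
proof -
  have "card {gen_a, inv\<^bsub>free_product k\<^esub> gen_a, gen_b, inv\<^bsub>free_product k\<^esub> gen_b} = 4"
    using assms(1) by (simp add: gen_a_def gen_b_def inv_gen[simplified])
  then show ?thesis
    unfolding simple_step_def using assms(2) by (subst pmf_of_set) auto
qed

text \<open>The universal property of the free product of two cyclic groups of order \<open>k\<close>.\<close>

lemma free_product_universal:
  fixes H (structure)
  assumes "group H" "2 \<le> k" "x \<in> carrier H" "y \<in> carrier H" "x [^] k = \<one>" "y [^] k = \<one>"
  shows "\<exists>\<phi> \<in> hom (free_product k) H. \<phi> gen_a = x \<and> \<phi> gen_b = y \<and>
    (\<forall>\<psi> \<in> hom (free_product k) H. \<psi> gen_a = x \<and> \<psi> gen_b = y \<longrightarrow>
       (\<forall>g \<in> carrier (free_product k). \<psi> g = \<phi> g))"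
proof -
  interpret H: group H by fact
  interpret G: group "free_product k" by (rule group_free_product)
  define z where "z f = (case f of FacA \<Rightarrow> x | FacB \<Rightarrow> y)" for f
  have z: "z f \<in> carrier H" "z f [^] k = \<one>" for f
    using assms by (cases f; simp add: z_def)+
  define \<theta> where "\<theta> u = z (fst u) [^] snd u" for u :: letter
  have \<theta>: "\<theta> u \<in> carrier H" for u
    by (simp add: \<theta>_def z)
  have modk: "z f [^] (n mod k) = z f [^] n" for f and n :: nat
  proof -
    have "z f [^] n = z f [^] (k * (n div k) + n mod k)" by simp
    also have "\<dots> = (z f [^] k) [^] (n div k) \<otimes> z f [^] (n mod k)"
      using z(1) by (simp only: H.nat_pow_mult[symmetric] H.nat_pow_pow)
    finally show ?thesis using z by simp
  qed
  define \<phi> where "\<phi> w = foldr (\<lambda>u h. \<theta> u \<otimes> h) w \<one>" for w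
  have \<phi>_closed: "\<phi> w \<in> carrier H" for w
    by (induction w) (auto simp: \<phi>_def \<theta>)
  have \<phi>_Cons: "\<phi> (u # w) = \<theta> u \<otimes> \<phi> w" for u w
    by (simp add: \<phi>_def)
  have \<phi>_letter: "\<phi> (letter_mult k u w) = \<theta> u \<otimes> \<phi> w" for u w
  proof (cases w)
    case (Cons v w')
    show ?thesis
    proof (cases "fst u = fst v")
      case True
      have "\<theta> u \<otimes> \<theta> v = z (fst u) [^] ((snd u + snd v) mod k)"
        using True z(1) unfolding \<theta>_def modk by (simp add: H.nat_pow_mult)
      then have "\<theta> u \<otimes> \<phi> w = z (fst u) [^] ((snd u + snd v) mod k) \<otimes> \<phi> w'"
        by (metis Cons \<phi>_Cons \<phi>_closed \<theta> H.m_assoc)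
      then show ?thesis
        using True \<phi>_closed[of w'] by (auto simp: Cons \<phi>_Cons \<theta>_def)
    qed (simp add: Cons \<phi>_Cons)
  qed (simp add: \<phi>_Cons)
  have "\<phi> (word_mult k g h) = \<phi> g \<otimes> \<phi> h" for g h
  proof (induction g)
    case Nil
    then show ?case using \<phi>_closed by (simp add: word_mult_def \<phi>_def)
  next
    case (Cons u g)
    then show ?case
      using \<phi>_letter[of u "word_mult k g h"] \<phi>_closed \<theta>
      by (simp add: word_mult_def \<phi>_Cons H.m_assoc)
  qed
  then have hom: "\<phi> \<in> hom (free_product k) H"
    using \<phi>_closed by (auto simp: hom_def free_product_def)
  have "\<psi> g = \<phi> g"
    if \<psi>: "\<psi> \<in> hom (free_product k) H" "\<psi> gen_a = x" "\<psi> gen_b = y"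
      and g: "g \<in> carrier (free_product k)" for \<psi> g
  proof -
    interpret \<psi>: group_hom "free_product k" H \<psi>
      by unfold_locales (rule \<psi>(1))
    have gen: "[(f, 1)] \<in> carrier (free_product k)" for f
      using assms(2) by (simp add: free_product_def reduced_words_Cons letters_iff)
    have \<psi>z: "\<psi> [(f, 1)] = z f" for f
      using \<psi>(2,3) by (cases f) (auto simp: z_def gen_a_def gen_b_def)
    have \<psi>\<theta>: "\<psi> [u] = \<theta> u" if "u \<in> letters k" for u
    proof -
      have "[u] = [(fst u, 1)] [^]\<^bsub>free_product k\<^esub> snd u"
        using that gen_pow[of "snd u" k "fst u"] by (simp add: letters_iff)
      then have "\<psi> [u] = \<psi> [(fst u, 1)] [^] snd u"
        by (metis \<psi>.hom_nat_pow gen)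
      then show ?thesis by (simp only: \<psi>z \<theta>_def)
    qed
    show ?thesis
      using g
    proof (induction g)
      case Nil
      then show ?case using \<psi>.hom_one by (simp add: free_product_def \<phi>_def)
    next
      case (Cons u g)
      then have u: "u \<in> letters k" and g: "g \<in> carrier (free_product k)"
        by (auto simp: free_product_def reduced_words_Cons)
      have "[u] \<otimes>\<^bsub>free_product k\<^esub> g = u # g"
        using Cons.prems by (cases g) (auto simp: free_product_def word_mult_def reduced_words_Cons)
      moreover have "[u] \<in> carrier (free_product k)"
        using u by (simp add: free_product_def reduced_words_Cons)
      ultimately have "\<psi> (u # g) = \<psi> [u] \<otimes> \<psi> g"
        using g by (metis \<psi>.hom_mult)
      then show ?case
        using Cons.IH[OF g] \<psi>\<theta>[OF u] by (simp add: \<phi>_Cons)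
    qed
  qed
  moreover have "\<phi> gen_a = x" "\<phi> gen_b = y"
    using assms(3,4) by (auto simp: gen_a_def gen_b_def \<phi>_def \<theta>_def z_def)
  ultimately show ?thesis using hom by blast
qed

end

theory Submission
  imports Defs "HOL-Real_Asymp.Real_Asymp"
begin

text \<open>
  Put \<open>p\<^sub>i = F i x\<^sub>k\<close>. The recurrence says exactly that \<open>p\<close> solves the one-step equations for the
  probability of ever deleting a syllable with exponent \<open>i\<close>, so products of the \<open>p\<^sub>i\<close> are
  hitting probabilities. They yield, for every cylinder, an explicit bounded harmonic function of the
  walk that tends to the indicator of the cylinder along almost every trajectory; by dominated
  convergence its value at the identity is the harmonic measure of the cylinder. Under this measure
  the factors alternate, starting with a fair coin, and the exponents are i.i.d. with law \<open>p\<close>. This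
  gives stationarity, and ergodicity since a shift invariant event is independent of all cylinders.

  For the drift, the additive functional with weight \<open>i (k - i)\<close> on a syllable with exponent \<open>i\<close>
  increases on average by \<open>(k - 2) / 2\<close> in every step away from the identity, and a bounded
  correction removes the exception. Hence it grows linearly, which also shows transience. Comparing
  with the average \<open>(k - 2) / (1 - x\<^sub>k)\<close> of these weights along the limit word gives the drift
  \<open>(1 - x\<^sub>k) / 2\<close>.
\<close>

text \<open>The length itself is unsuitable for a strong law: for \<open>k \<ge> 4\<close> its mean
  increment depends on the last exponent, since only the exponents \<open>1\<close> and
  \<open>k - 1\<close> can vanish in one step. The weight \<open>i (k - i)\<close> repairs this. It
  is zero at \<open>0\<close> and \<open>k\<close>, its second difference is \<open>-2\<close>, and
  every new letter brings \<open>k - 1\<close>, so the last exponent drops out of the mean. The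
  price is the conversion back to letters, which requires the settled prefix of the walk to lag
  behind the walk by only \<open>o(n)\<close> letters. The formula for \<open>hit\<close> comes from
  a heuristic. A walk in a wrong branch must erase everything behind the branching point, at the
  cost of one weight per letter. After that, translation and symmetry give the letters still missing
  from the target the same weights, and the factor \<open>1/2\<close> is the choice between the two
  cyclic factors. What is proved about \<open>hit\<close> is harmonicity in the starting point and
  the limit along trajectories; together these determine the law.\<close>

section \<open>The polynomials \<open>F n\<close> and the roots \<open>x\<^sub>k\<close>\<close>

text \<open>
  With \<open>z = tanh\<^sup>2 t\<close> and \<open>2 - x = cosh (2 t)\<close>, the ratio \<open>tanh_ratio z n\<close> is
  \<open>tanh (n t) / tanh t\<close>, and \<open>F n x = cosh (2 n t) - 2 tanh t sinh (2 n t)\<close>.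
\<close>
fun tanh_ratio :: "real \<Rightarrow> nat \<Rightarrow> real" where
  "tanh_ratio z 0 = 0"
| "tanh_ratio z (Suc n) = (tanh_ratio z n + 1) / (1 + z * tanh_ratio z n)"

lemma tanh_ratio_nonneg: "0 \<le> z \<Longrightarrow> 0 \<le> tanh_ratio z n"
  by (induction n) (auto intro!: divide_nonneg_nonneg add_nonneg_nonneg)

lemma tanh_ratio_denom_pos: "0 \<le> z \<Longrightarrow> 0 < 1 + z * tanh_ratio z n"
  using tanh_ratio_nonneg[of z n] by (simp add: add_pos_nonneg)

text \<open>In the hyperbolic picture this is \<open>tanh (n t) ^ 2 < 1\<close>. The step is the
  identity \<open>(1 + z R)^2 - z (R + 1)^2 = (1 - z) (1 - z R^2)\<close>.\<close>

lemma tanh_ratio_bound: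
  assumes "0 \<le> z" "z < 1"
  shows "z * (tanh_ratio z n)\<^sup>2 < 1"
proof (induction n)
  case (Suc n)
  define R where "R = tanh_ratio z n"
  have d: "0 < 1 + z * R"
    using tanh_ratio_denom_pos assms(1) by (simp add: R_def)
  have "0 < (1 - z) * (1 - z * R\<^sup>2)"
    using Suc assms by (simp add: R_def)
  then have "z * (R + 1)\<^sup>2 < (1 + z * R)\<^sup>2"
    by (simp add: power2_eq_square algebra_simps)
  then show ?case
    using d by (simp add: R_def[symmetric] power_divide divide_simps)
qed simp

text \<open>The increment is \<open>(1 - z R^2) / (1 + z R)\<close>.\<close>

lemma tanh_ratio_Suc_less:
  assumes "0 \<le> z" "z < 1"
  shows "tanh_ratio z n < tanh_ratio z (Suc n)"
  using tanh_ratio_bound[OF assms, of n] tanh_ratio_denom_pos[OF assms(1), of n]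
  by (simp add: field_simps power2_eq_square)

text \<open>For \<open>z < 1\<close> the expression \<open>(R + 1) / (1 + z R)\<close> increases in
  \<open>R\<close> and decreases in \<open>z\<close>, so both effects add up along the recursion.
  Strictness begins with the second term, because the first is \<open>1\<close> for every
  \<open>z\<close>.\<close>

lemma tanh_ratio_Suc_antimono:
  assumes "0 \<le> z" "z < z'" "z' < 1"
  shows "tanh_ratio z' (Suc n) \<le> tanh_ratio z (Suc n) \<and>
    (0 < n \<longrightarrow> tanh_ratio z' (Suc n) < tanh_ratio z (Suc n))"
proof (induction n)
  case (Suc n)
  define R R' where "R = tanh_ratio z (Suc n)" and "R' = tanh_ratio z' (Suc n)"
  have pos: "0 < R" "0 < R'"
    using tanh_ratio_Suc_less[of z n] tanh_ratio_Suc_less[of z' n]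
      tanh_ratio_nonneg[of z n] tanh_ratio_nonneg[of z' n] assms by (auto simp: R_def R'_def)
  have le: "R' \<le> R" using Suc by (simp add: R_def R'_def)
  have d: "0 < 1 + z * R" "0 < 1 + z' * R'" "0 < 1 + z' * R"
    using pos assms by (auto intro!: add_pos_nonneg)
  have "(R' + 1) / (1 + z' * R') \<le> (R + 1) / (1 + z' * R)"
  proof -
    have "0 \<le> (1 - z') * (R - R')" using le assms by simp
    then show ?thesis using d by (simp add: divide_simps algebra_simps)
  qed
  also have "\<dots> < (R + 1) / (1 + z * R)"
    using d pos assms by (intro divide_strict_left_mono mult_pos_pos) auto
  finally show ?case by (simp add: R_def R'_def)
qed simp

lemma continuous_on_tanh_ratio: "continuous_on {0..} (\<lambda>z. tanh_ratio z n)"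
proof (induction n)
  case (Suc n)
  show ?case
    using tanh_ratio_denom_pos[of _ n]
    by (auto intro!: continuous_intros Suc simp: less_imp_neq[symmetric])
qed simp

lemma tanh_ratio_0: "tanh_ratio 0 n = n"
  by (induction n) auto

text \<open>With \<open>cosh (2 t) = 2 - x\<close> this is
  \<open>(cosh (2 t) - 1) / (cosh (2 t) + 1)\<close>, that is \<open>tanh t ^ 2\<close>. It
  decreases in \<open>x\<close> and maps the open unit interval onto the open interval from
  \<open>0\<close> to \<open>1/3\<close>.\<close>

definition tanh_sq :: "real \<Rightarrow> real" where
  "tanh_sq x = (1 - x) / (3 - x)"

lemma tanh_sq_bounds: "x \<in> {0<..<1} \<Longrightarrow> 0 < tanh_sq x \<and> tanh_sq x < 1 / 3"
  by (auto simp: tanh_sq_def field_simps)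

lemma inv_tanh_sq:
  assumes "z \<in> {0<..<1/3}" "x = (1 - 3 * z) / (1 - z)"
  shows "x \<in> {0<..<1}" "tanh_sq x = z"
proof -
  have z: "0 < z" "z < 1/3" using assms(1) by auto
  show "x \<in> {0<..<1}" using z by (auto simp: assms(2) field_simps)
  have "1 - x = 2 * z / (1 - z)" "3 - x = 2 / (1 - z)"
    using z by (auto simp: assms(2) field_simps)
  then show "tanh_sq x = z" using z by (simp add: tanh_sq_def)
qed

text \<open>The hyperbolic form of \<open>F n x\<close>, rewritten with
  \<open>cosh (2 s) = (1 + T^2) / (1 - T^2)\<close> and \<open>sinh (2 s) = 2 T / (1 - T^2)\<close>
  for \<open>s = n t\<close> and \<open>T = tanh s\<close>.\<close>

lemma F_tanh_ratio:
  assumes "x \<in> {0<..<1}"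
  defines "z \<equiv> tanh_sq x"
  shows "F n x = (1 + z * (tanh_ratio z n)\<^sup>2 - 4 * z * tanh_ratio z n) / (1 - z * (tanh_ratio z n)\<^sup>2)"
proof -
  have z: "0 < z" "z < 1 / 3" using tanh_sq_bounds[OF assms(1)] by (auto simp: z_def)
  have x: "x = (1 - 3 * z) / (1 - z)"
    using assms(1) z by (simp add: z_def tanh_sq_def field_simps)
  have x2: "2 - x = (1 + z) / (1 - z)"
    using z by (simp add: x field_simps)
  show ?thesis
  proof (induction n rule: induct_nat_012)
    case 1
    then show ?case using z by (simp add: x)
  next
    case (ge2 n)
    \<comment> \<open>Both neighbours of \<open>R\<close> are Moebius images of it,
      \<open>(R - 1) / (1 - z R)\<close> backwards and \<open>(R + 1) / (1 + z R)\<close> forwards.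
      The three-term recurrence becomes an identity in \<open>z\<close> and \<open>R\<close>, and
      \<open>dm\<close> gives both neighbours the same denominator.\<close>
    define R where "R = tanh_ratio z (Suc n)"
    define Q where "Q = tanh_ratio z n"
    have "0 < 1 + z * Q"
      using tanh_ratio_denom_pos[of z n] z by (simp add: Q_def)
    then have "(1 + z * Q) * R = Q + 1" by (simp add: R_def Q_def)
    then have RQ: "(1 - z * R) * Q = R - 1" by (simp add: algebra_simps)
    have R: "z * R\<^sup>2 < 1" "0 < R"
      using tanh_ratio_bound[of z "Suc n"] tanh_ratio_Suc_less[of z n] tanh_ratio_nonneg[of z n] z
      by (auto simp: R_def)
    have "(z * R)\<^sup>2 \<le> z * R\<^sup>2"
      using z by (simp add: power_mult_distrib power2_eq_square[of z] mult_right_mono)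
    then have "(z * R)\<^sup>2 < 1\<^sup>2" using R by simp
    then have zR: "z * R < 1" by (rule power_less_imp_less_base) simp
    have Q: "Q = (R - 1) / (1 - z * R)" using RQ zR by (simp add: field_simps)
    have d: "1 - z * R \<noteq> 0" "1 + z * R \<noteq> 0" "1 - z * R\<^sup>2 \<noteq> 0" "1 - z \<noteq> 0"
      using zR R z by (auto simp: add_pos_pos less_imp_neq[symmetric])
    have general: "(1 + z * (a / b)\<^sup>2 - 4 * z * (a / b)) / (1 - z * (a / b)\<^sup>2)
        = (b\<^sup>2 + z * a\<^sup>2 - 4 * z * a * b) / (b\<^sup>2 - z * a\<^sup>2)" if "b \<noteq> 0" for a b :: real
      using that by (simp add: divide_simps power2_eq_square)
    have dm: "(1 - z * R)\<^sup>2 - z * (R - 1)\<^sup>2 = (1 - z) * (1 - z * R\<^sup>2)"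
      "(1 + z * R)\<^sup>2 - z * (R + 1)\<^sup>2 = (1 - z) * (1 - z * R\<^sup>2)"
      by (simp_all add: power2_eq_square algebra_simps)
    have FQ: "F n x = ((1 - z * R)\<^sup>2 + z * (R - 1)\<^sup>2 - 4 * z * (R - 1) * (1 - z * R)) / ((1 - z) * (1 - z * R\<^sup>2))"
      using ge2(1) unfolding Q_def[symmetric] Q general[OF d(1)] dm .
    have "F (Suc (Suc n)) x = 2 * ((1 + z) / (1 - z)) * ((1 + z * R\<^sup>2 - 4 * z * R) / (1 - z * R\<^sup>2)) - F n x"
      using ge2(2) by (simp add: R_def x2 del: tanh_ratio.simps)
    also have "\<dots> = ((1 + z * R)\<^sup>2 + z * (R + 1)\<^sup>2 - 4 * z * (R + 1) * (1 + z * R)) / ((1 - z) * (1 - z * R\<^sup>2))"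
      unfolding FQ using d by (simp add: divide_simps) (simp add: power2_eq_square algebra_simps)
    also have "\<dots> = (1 + z * (tanh_ratio z (Suc (Suc n)))\<^sup>2 - 4 * z * tanh_ratio z (Suc (Suc n)))
        / (1 - z * (tanh_ratio z (Suc (Suc n)))\<^sup>2)"
      using general[OF d(2), of "R + 1"] dm by (simp add: R_def)
    finally show ?case .
  qed simp
qed

text \<open>Clearing denominators leaves \<open>2 z R^2 = 4 z R\<close> with \<open>R > 0\<close>.
  The root equation thus reads \<open>tanh (n t) = 2 tanh t\<close>, a form that is monotone in
  \<open>z\<close>.\<close>

lemma F_eq_1_iff:
  assumes "x \<in> {0<..<1}" "0 < n"
  shows "F n x = 1 \<longleftrightarrow> tanh_ratio (tanh_sq x) n = 2"
proof -
  define z where "z = tanh_sq x"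
  define R where "R = tanh_ratio z n"
  have z: "0 < z" "z < 1 / 3" using tanh_sq_bounds[OF assms(1)] by (auto simp: z_def)
  have "0 < R"
    using tanh_ratio_Suc_less[of z "n - 1"] tanh_ratio_nonneg[of z "n - 1"] z assms(2)
    by (auto simp: R_def)
  moreover have "1 - z * R\<^sup>2 \<noteq> 0"
    using tanh_ratio_bound[of z n] z by (simp add: R_def)
  ultimately have "F n x = 1 \<longleftrightarrow> 2 * z * R * R = 2 * z * R * 2"
    unfolding F_tanh_ratio[OF assms(1), of n] z_def[symmetric] R_def[symmetric]
    by (simp add: divide_eq_1_iff power2_eq_square)
  then show ?thesis
    using z \<open>0 < R\<close> by (simp add: R_def z_def)
qed

text \<open>Intermediate values: the ratio is \<open>k > 2\<close> at \<open>z = 0\<close>, while at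
  \<open>z = 1/3\<close> the bound \<open>z R^2 < 1\<close> gives \<open>R^2 < 3\<close>.\<close>

lemma tanh_ratio_eq_2:
  assumes "3 \<le> k"
  shows "\<exists>z. 0 < z \<and> z < 1 / 3 \<and> tanh_ratio z k = 2"
proof -
  have "tanh_ratio (1/3) k < 2"
  proof (rule ccontr)
    assume "\<not> tanh_ratio (1/3) k < 2"
    then have "2\<^sup>2 \<le> (tanh_ratio (1/3) k)\<^sup>2" by (intro power_mono) auto
    then show False using tanh_ratio_bound[of "1/3" k] by simp
  qed
  moreover have "2 < tanh_ratio 0 k" using assms by (simp add: tanh_ratio_0)
  moreover have "\<exists>z. 0 \<le> z \<and> z \<le> 1/3 \<and> tanh_ratio z k = 2"
    using calculation by (intro IVT2' continuous_on_subset[OF continuous_on_tanh_ratio]) auto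
  ultimately show ?thesis by (metis less_irrefl less_le)
qed

lemma F_root_ex1:
  assumes "3 \<le> k"
  shows "\<exists>!x. x \<in> {0<..<1} \<and> F k x = 1"
proof -
  obtain z where z: "0 < z" "z < 1/3" "tanh_ratio z k = 2"
    using tanh_ratio_eq_2[OF assms] by blast
  define x where "x = (1 - 3 * z) / (1 - z)"
  have x: "x \<in> {0<..<1}" "tanh_sq x = z"
    using inv_tanh_sq[of z x] z by (auto simp: x_def)
  show ?thesis
  proof (rule ex1I[of _ x])
    show "x \<in> {0<..<1} \<and> F k x = 1"
      using x z F_eq_1_iff[of x k] assms by auto
  next
    fix y assume y: "y \<in> {0<..<1} \<and> F k y = 1"
    then have "tanh_ratio (tanh_sq y) k = tanh_ratio z k"
      using F_eq_1_iff[of y k] assms z by auto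
    moreover have "0 < tanh_sq y \<and> tanh_sq y < 1 / 3" using y tanh_sq_bounds by blast
    ultimately have "tanh_sq y = tanh_sq x"
      using tanh_ratio_Suc_antimono[of "tanh_sq y" z "k - 1"]
        tanh_ratio_Suc_antimono[of z "tanh_sq y" "k - 1"] z assms x
      by (cases "tanh_sq y" z rule: linorder_cases) auto
    then show "y = x" using x y by (auto simp: tanh_sq_def field_simps)
  qed
qed

section \<open>Values of \<open>F\<close> at the root: positivity, symmetry and two sums\<close>

context
  fixes k :: nat
  assumes k: "3 \<le> k"
begin

lemma root_F: "0 < root_F k" "root_F k < 1" "F k (root_F k) = 1"
  using theI'[OF F_root_ex1[OF k]] unfolding root_F_def by auto

lemma tanh_ratio_root: "tanh_ratio (tanh_sq (root_F k)) k = 2"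
  using F_eq_1_iff[of "root_F k" k] root_F k by simp

text \<open>At the root the ratio is \<open>2\<close>, so \<open>z R^2 < 1\<close> sharpens the
  bound \<open>1/3\<close> to \<open>1/4\<close>, which is also the limit of \<open>z\<close> for
  large \<open>k\<close>.\<close>

lemma tanh_sq_root_bounds: "0 < tanh_sq (root_F k)" "tanh_sq (root_F k) < 1 / 4"
proof -
  have b: "0 < tanh_sq (root_F k) \<and> tanh_sq (root_F k) < 1 / 3"
    using root_F tanh_sq_bounds by simp
  then show "0 < tanh_sq (root_F k)" by simp
  show "tanh_sq (root_F k) < 1 / 4"
    using tanh_ratio_bound[of "tanh_sq (root_F k)" k] b tanh_ratio_root by simp
qed

lemma F_root_pos: "0 < F n (root_F k)"
proof -
  define z R where "z = tanh_sq (root_F k)" and "R = tanh_ratio z n"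
  have z: "0 < z" "z < 1 / 4" using tanh_sq_root_bounds by (auto simp: z_def)
  \<comment> \<open>Completes the square in the numerator of \<open>F_tanh_ratio\<close>; the
    remaining constant is positive because \<open>z < 1/4\<close>.\<close>
  have "0 < z * (R - 2)\<^sup>2 + (1 - 4 * z)" using z by (intro add_nonneg_pos) auto
  then have "0 < 1 + z * R\<^sup>2 - 4 * z * R" by (simp add: power2_eq_square algebra_simps)
  moreover have "0 < 1 - z * R\<^sup>2" using tanh_ratio_bound[of z n] z by (simp add: R_def)
  ultimately show ?thesis
    using F_tanh_ratio[of "root_F k" n] root_F by (simp add: z_def R_def)
qed

text \<open>The recurrence is invariant under reversing the indices, so two neighbouring values
  suffice. The end value is the root equation; its neighbour is found by solving
  \<open>tanh_ratio z k = 2\<close> backwards for \<open>tanh_ratio z (k - 1)\<close>.\<close>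

lemma F_root_symmetric: "i \<le> k \<Longrightarrow> F (k - i) (root_F k) = F i (root_F k)"
proof (induction i rule: induct_nat_012)
  case 0
  then show ?case using root_F by simp
next
  case 1
  define x where "x = root_F k"
  define z where "z = tanh_sq x"
  have z: "0 < z" "z < 1 / 4" using tanh_sq_root_bounds by (auto simp: z_def x_def)
  have x: "x \<in> {0<..<1}" using root_F by (simp add: x_def)
  have xz: "x = (1 - 3 * z) / (1 - z)"
    using x z by (simp add: z_def tanh_sq_def field_simps)
  define Q where "Q = tanh_ratio z (k - 1)"
  have "tanh_ratio z (Suc (k - 1)) = 2" using tanh_ratio_root k by (simp add: z_def x_def)
  moreover have "0 < 1 + z * Q" using tanh_ratio_denom_pos[of z "k - 1"] z by (simp add: Q_def)
  ultimately have "Q + 1 = 2 * (1 + z * Q)" by (simp add: Q_def divide_eq_eq)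
  then have Q: "Q = 1 / (1 - 2 * z)" using z by (simp add: field_simps)
  have n: "1 + z * Q\<^sup>2 - 4 * z * Q = (1 - 3 * z) * (1 - 4 * z) / (1 - 2 * z)\<^sup>2"
    "1 - z * Q\<^sup>2 = (1 - z) * (1 - 4 * z) / (1 - 2 * z)\<^sup>2"
    using z by (simp_all add: Q divide_simps power2_eq_square) (simp_all add: algebra_simps)
  have "F (k - 1) x = x"
    using F_tanh_ratio[OF x, of "k - 1"] z unfolding z_def[symmetric] Q_def[symmetric] n
    by (simp add: xz)
  then show ?case by (simp add: x_def)
next
  case (ge2 i)
  have "k - i = Suc (Suc (k - Suc (Suc i)))" "k - Suc i = Suc (k - Suc (Suc i))"
    using ge2.prems by auto
  then show ?case using ge2 by simp
qed

lemma F_root_harmonic: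
  assumes "0 < i"
  shows "F (i - 1) (root_F k) + F (i + 1) (root_F k) = 2 * (2 - root_F k) * F i (root_F k)"
proof -
  obtain j where "i = Suc j" using assms by (cases i) auto
  then show ?thesis by simp
qed

text \<open>The second difference of \<open>p\<close> is \<open>2 (1 - x) p\<close>. Its sum
  telescopes to the difference of the boundary slopes, which are \<open>1 - x\<close> and
  \<open>- (1 - x)\<close> by symmetry.\<close>

lemma sum_F_root: "(\<Sum>i=1..<k. F i (root_F k)) = 1"
proof -
  define p where "p i = F i (root_F k)" for i
  have "(\<Sum>i=1..<k. (p (i + 1) - p i) - (p i - p (i - 1))) = (\<Sum>i=1..<k. 2 * (1 - root_F k) * p i)"
    using F_root_harmonic by (intro sum.cong refl) (auto simp: p_def algebra_simps)
  moreover have "(\<Sum>i=1..<n+1. (p (i + 1) - p i) - (p i - p (i - 1))) = (p (n + 1) - p n) - (p 1 - p 0)" for n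
    by (induction n) auto
  from this[of "k - 1"] have "(\<Sum>i=1..<k. (p (i + 1) - p i) - (p i - p (i - 1))) = (p k - p (k - 1)) - (p 1 - p 0)"
    using k by simp
  moreover have "p k = 1" "p (k - 1) = root_F k" "p 0 = 1" "p 1 = root_F k"
    using F_root_symmetric[of 0] F_root_symmetric[of 1] k by (auto simp: p_def root_F)
  ultimately have "2 * (1 - root_F k) * (\<Sum>i=1..<k. p i) = 2 * (1 - root_F k)"
    by (simp add: sum_distrib_left)
  then show ?thesis using root_F by (simp add: p_def)
qed

text \<open>Summation by parts against \<open>c i = i (k - i)\<close>, whose second difference is
  \<open>-2\<close>: only boundary terms and the sum of \<open>p\<close> remain.\<close>

lemma sum_weighted_F_root:
  "(\<Sum>i=1..<k. real (i * (k - i)) * F i (root_F k)) = (real k - 2) / (1 - root_F k)"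
proof -
  define p where "p i = F i (root_F k)" for i
  define c where "c i = real i * (real k - real i)" for i
  have ends: "p k = 1" "p (k - 1) = root_F k" "p 0 = 1" "p 1 = root_F k"
    using F_root_symmetric[of 0] F_root_symmetric[of 1] k by (auto simp: p_def root_F)
  have step: "c i * (2 * (1 - root_F k) * p i) =
      (c i * (p (i + 1) - p i) - p i * (c (i + 1) - c i)) -
      (c (i - 1) * (p i - p (i - 1)) - p (i - 1) * (c i - c (i - 1))) - 2 * p i"
    if i: "i \<in> {1..<k}" for i
  proof -
    have e: "2 * (1 - root_F k) * p i = p (i + 1) + p (i - 1) - 2 * p i"
      using F_root_harmonic[of i] i by (simp add: p_def algebra_simps)
    have "c (i + 1) = c i + real k - 2 * real i - 1" "c (i - 1) = c i - real k + 2 * real i - 1"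
      using i by (auto simp: c_def algebra_simps of_nat_diff)
    then have "c (i + 1) + c (i - 1) = 2 * c i - 2" by simp
    then have "p i * (c (i + 1) + c (i - 1)) = p i * (2 * c i - 2)" by simp
    then show ?thesis unfolding e by (simp add: algebra_simps)
  qed
  \<comment> \<open>The discrete Wronskian of \<open>c\<close> and \<open>p\<close>; the two
    brackets in \<open>step\<close> are its values at \<open>i\<close> and
    \<open>i - 1\<close>.\<close>
  define T where "T i = c i * (p (i + 1) - p i) - p i * (c (i + 1) - c i)" for i
  have "(\<Sum>i=1..<k. c i * (2 * (1 - root_F k) * p i)) = (\<Sum>i=1..<k. (T i - T (i - 1)) - 2 * p i)"
    using step by (intro sum.cong refl) (auto simp: T_def)
  also have "\<dots> = (\<Sum>i=1..<k. T i - T (i - 1)) - 2 * (\<Sum>i=1..<k. p i)"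
    by (simp add: sum_subtractf sum_distrib_left)
  also have "(\<Sum>i=1..<n+1. T i - T (i - 1)) = T n - T 0" for n
    by (induction n) auto
  from this[of "k - 1"] have "(\<Sum>i=1..<k. T i - T (i - 1)) = T (k - 1) - T 0" using k by simp
  also have "T (k - 1) - T 0 = 2 * (real k - 1)"
    using k ends by (simp add: T_def c_def of_nat_diff algebra_simps)
  finally have "(2 * (1 - root_F k)) * (\<Sum>i=1..<k. c i * p i) = 2 * (real k - 2)"
    using sum_F_root by (simp add: p_def[symmetric] sum_distrib_left[symmetric] mult_ac del: One_nat_def)
      (simp add: sum_distrib_left mult_ac)
  moreover have "(\<Sum>i=1..<k. real (i * (k - i)) * F i (root_F k)) = (\<Sum>i=1..<k. c i * p i)"
    by (intro sum.cong refl) (auto simp: c_def p_def of_nat_diff)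
  ultimately show ?thesis using root_F by (simp add: field_simps)
qed

section \<open>Monotonicity and limit of the roots\<close>

lemma root_F_Suc_less: "root_F (Suc k) < root_F k"
proof -
  \<comment> \<open>At the parameter belonging to \<open>k\<close> the ratio is \<open>2\<close>
    after \<open>k\<close> steps and already larger after \<open>k + 1\<close>, so a larger
    parameter is needed to bring it back to \<open>2\<close>.\<close>
  have lt: "tanh_sq (root_F k) < tanh_sq (root_F (Suc k))"
  proof (rule ccontr)
    define z z' where "z = tanh_sq (root_F k)" and "z' = tanh_sq (root_F (Suc k))"
    assume "\<not> tanh_sq (root_F k) < tanh_sq (root_F (Suc k))"
    then have "z' \<le> z" by (simp add: z_def z'_def)
    moreover have k': "3 \<le> Suc k" using k by simp
    have Sk: "0 < root_F (Suc k)" "root_F (Suc k) < 1" "F (Suc k) (root_F (Suc k)) = 1"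
      using theI'[OF F_root_ex1[OF k']] unfolding root_F_def by auto
    then have "tanh_ratio z' (Suc k) = 2" "0 < z'"
      using F_eq_1_iff[of "root_F (Suc k)" "Suc k"] tanh_sq_bounds by (auto simp: z'_def)
    moreover have z: "0 < z" "z < 1/4" using tanh_sq_root_bounds by (auto simp: z_def)
    moreover have "tanh_ratio z k = 2" using tanh_ratio_root by (simp add: z_def)
    moreover have "tanh_ratio z (Suc k) \<le> tanh_ratio z' (Suc k)"
      using \<open>z' \<le> z\<close> \<open>0 < z'\<close> z tanh_ratio_Suc_antimono[of z' z k] by (cases "z' = z") auto
    ultimately show False using tanh_ratio_Suc_less[of z k] by simp
  qed
  show ?thesis
  proof (rule ccontr)
    assume "\<not> root_F (Suc k) < root_F k"
    moreover have "root_F (Suc k) < 1"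
      using theI'[OF F_root_ex1[of "Suc k"]] k unfolding root_F_def by auto
    ultimately have "tanh_sq (root_F (Suc k)) \<le> tanh_sq (root_F k)"
      using root_F by (simp add: tanh_sq_def frac_le divide_simps algebra_simps)
    then show False using lt by simp
  qed
qed

text \<open>As long as the ratio is at most \<open>2\<close>, each step raises it by
  \<open>(1 - z R^2) / (1 + z R)\<close>, hence by at least \<open>(1 - 4 z) / 2\<close>. It climbs
  from \<open>1\<close> to \<open>2\<close> in \<open>k - 1\<close> steps, which bounds
  \<open>1 - 4 z\<close>.\<close>

lemma tanh_sq_root_lower: "1 / 4 - tanh_sq (root_F k) \<le> 1 / (2 * (real k - 1))"
proof -
  define z where "z = tanh_sq (root_F k)"
  have z: "0 < z" "z < 1/4" using tanh_sq_root_bounds by (auto simp: z_def)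
  have mono: "tanh_ratio z m \<le> tanh_ratio z n" if "m \<le> n" for m n
    using tanh_ratio_Suc_less[of z] z by (intro lift_Suc_mono_le[OF _ that]) (auto intro: less_imp_le)
  have "1 + real n * ((1 - 4 * z) / 2) \<le> tanh_ratio z (Suc n)" if "Suc n \<le> k" for n
    using that
  proof (induction n)
    case (Suc n)
    define R where "R = tanh_ratio z (Suc n)"
    have R: "R \<le> 2" "0 \<le> R"
      using mono[of "Suc n" k] Suc.prems tanh_ratio_root tanh_ratio_nonneg[of z "Suc n"] z by (auto simp: R_def z_def)
    have "z * R \<le> 1 / 4 * 2" using R z by (intro mult_mono) auto
    then have zR: "0 < 1 + z * R" "1 + z * R \<le> 2" using R z by (auto intro: add_pos_nonneg)
    have "R\<^sup>2 \<le> 2\<^sup>2" using R by (intro power_mono) auto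
    then have "1 - 4 * z \<le> 1 - z * R\<^sup>2" using z by simp
    have "(1 - 4 * z) / 2 \<le> (1 - 4 * z) / (1 + z * R)"
      using zR z by (intro divide_left_mono) auto
    also have "\<dots> \<le> (1 - z * R\<^sup>2) / (1 + z * R)"
      using zR \<open>1 - 4 * z \<le> 1 - z * R\<^sup>2\<close> by (intro divide_right_mono) auto
    also have "\<dots> = (R + 1) / (1 + z * R) - R" using zR by (simp add: field_simps power2_eq_square)
    also have "(R + 1) / (1 + z * R) = tanh_ratio z (Suc (Suc n))" by (simp add: R_def)
    finally have "R + (1 - 4 * z) / 2 \<le> tanh_ratio z (Suc (Suc n))" by linarith
    moreover have "1 + real n * ((1 - 4 * z) / 2) \<le> R"
      using Suc unfolding R_def by simp
    moreover have "1 + real (Suc n) * ((1 - 4 * z) / 2) = 1 + real n * ((1 - 4 * z) / 2) + (1 - 4 * z) / 2"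
      by (simp only: of_nat_Suc distrib_right)
    ultimately show ?case by linarith
  qed simp
  from this[of "k - 1"] have "(real k - 1) * ((1 - 4 * z) / 2) \<le> 1"
    using k tanh_ratio_root by (simp add: z_def of_nat_diff)
  then show ?thesis using k by (simp add: z_def field_simps)
qed

end

lemma root_F_tendsto: "root_F \<longlonglongrightarrow> 1 / 3"
proof -
  have "(\<lambda>k. 1 / (2 * (real k - 1))) \<longlonglongrightarrow> 0" by real_asymp
  have "(\<lambda>k. 1 / 4 - tanh_sq (root_F k)) \<longlonglongrightarrow> 0"
  proof (rule tendsto_sandwich[OF _ _ tendsto_const \<open>_ \<longlonglongrightarrow> 0\<close>])
    show "\<forall>\<^sub>F k in sequentially. 0 \<le> 1 / 4 - tanh_sq (root_F k)"
      using eventually_ge_at_top[of 3] by eventually_elim (use tanh_sq_root_bounds in \<open>simp add: less_imp_le\<close>)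
    show "\<forall>\<^sub>F k in sequentially. 1 / 4 - tanh_sq (root_F k) \<le> 1 / (2 * (real k - 1))"
      using eventually_ge_at_top[of 3] by eventually_elim (rule tanh_sq_root_lower)
  qed
  from tendsto_diff[OF tendsto_const[of "1/4"] this] have "(\<lambda>k. tanh_sq (root_F k)) \<longlonglongrightarrow> 1 / 4" by simp
  then have "(\<lambda>k. (1 - 3 * tanh_sq (root_F k)) / (1 - tanh_sq (root_F k))) \<longlonglongrightarrow> (1 - 3 * (1/4)) / (1 - 1/4)"
    by (intro tendsto_intros) auto
  moreover have "\<forall>\<^sub>F k in sequentially. (1 - 3 * tanh_sq (root_F k)) / (1 - tanh_sq (root_F k)) = root_F k"
    using eventually_ge_at_top[of 3]
  proof eventually_elim
    case (elim k)
    then show ?case using root_F[of k] by (simp add: tanh_sq_def field_simps)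
  qed
  ultimately show ?thesis by (auto simp: tendsto_cong)
qed

section \<open>Functionals of i.i.d. sequences\<close>

lemma exp_le_quadratic:
  fixes x :: real
  assumes "\<bar>x\<bar> \<le> 1"
  shows "exp x \<le> 1 + x + x\<^sup>2"
proof (cases "0 \<le> x")
  case True
  then show ?thesis using assms exp_bound by simp
next
  case False
  define y where "y = - x"
  have y: "0 < y" "y \<le> 1" using False assms by (auto simp: y_def)
  \<comment> \<open>The excess over \<open>1\<close> of
    \<open>(1 - y + y^2) (1 + y + y^2 / 2)\<close>, whose second factor is a lower bound for
    \<open>exp y\<close>.\<close>
  have "0 \<le> y\<^sup>2 / 2 + y ^ 3 / 2 + y ^ 4 / 2" using y by simp
  then have "1 \<le> (1 - y + y\<^sup>2) * (1 + y + y\<^sup>2 / 2)"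
    by (simp add: algebra_simps power2_eq_square power3_eq_cube power4_eq_xxxx add_divide_distrib diff_divide_distrib)
  also have "\<dots> \<le> (1 - y + y\<^sup>2) * exp y"
    using y exp_lower_Taylor_quadratic[of y] by (intro mult_left_mono) auto
  finally have "1 \<le> (1 - y + y\<^sup>2) * exp y" .
  then have "exp (- y) \<le> 1 - y + y\<^sup>2"
    by (simp add: exp_minus field_simps)
  then show ?thesis by (simp add: y_def)
qed

lemma prob_space_stream_pmf: "prob_space (stream_space (measure_pmf \<mu>))"
  by (rule prob_space.prob_space_stream_space[OF prob_space_measure_pmf])

lemma measurable_stake_pmf [measurable]:
  fixes \<mu> :: "'a::countable pmf"
  shows "stake n \<in> measurable (stream_space (measure_pmf \<mu>)) (count_space UNIV)"
  using measurable_stake[of n] by (simp cong: measurable_cong_sets sets_stream_space_cong)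

lemma foldl_stake_measurable [measurable]:
  fixes \<mu> :: "'a::countable pmf"
  shows "(\<lambda>\<omega>. g (foldl step s (stake n \<omega>))) \<in> borel_measurable (stream_space (measure_pmf \<mu>))"
  by (rule measurable_compose[OF measurable_stake_pmf]) simp

section \<open>A strong law for Markov functionals with constant mean increment\<close>

context
  fixes \<mu> :: "'a::countable pmf" and step :: "'s \<Rightarrow> 'a \<Rightarrow> 's" and h :: "'s \<Rightarrow> real"
    and S :: "'s set" and d K :: real
  assumes closed: "\<And>s x. s \<in> S \<Longrightarrow> x \<in> set_pmf \<mu> \<Longrightarrow> step s x \<in> S"
    and bounded: "\<And>s x. s \<in> S \<Longrightarrow> x \<in> set_pmf \<mu> \<Longrightarrow> \<bar>h (step s x) - h s - d\<bar> \<le> K"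
    and mean: "\<And>s. s \<in> S \<Longrightarrow> measure_pmf.expectation \<mu> (\<lambda>x. h (step s x)) = h s + d"
    and K: "0 < K"
begin

text \<open>The increment minus \<open>d\<close> is centred, so the linear term of
  \<open>exp y \<le> 1 + y + y^2\<close> integrates to zero.\<close>

lemma exp_increment:
  assumes "\<bar>t\<bar> * K \<le> 1" "s \<in> S"
  shows "(\<integral>\<^sup>+x. ennreal (exp (t * (h (step s x) - h s - d))) \<partial>measure_pmf \<mu>) \<le> ennreal (1 + t\<^sup>2 * K\<^sup>2)"
proof -
  define D where "D x = h (step s x) - h s - d" for x
  have D: "AE x in measure_pmf \<mu>. \<bar>D x\<bar> \<le> K"
    using bounded[OF assms(2)] by (simp add: AE_measure_pmf_iff D_def)
  have iD: "integrable \<mu> D"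
    using D by (intro measure_pmf.integrable_const_bound[where B=K]) auto
  have "(\<lambda>x. h (step s x)) = (\<lambda>x. D x + (h s + d))"
    by (auto simp: D_def)
  then have "measure_pmf.expectation \<mu> (\<lambda>x. h (step s x)) = measure_pmf.expectation \<mu> D + (h s + d)"
    using iD by simp
  then have ED: "measure_pmf.expectation \<mu> D = 0"
    using mean[OF assms(2)] by simp
  have "(\<integral>\<^sup>+x. ennreal (exp (t * D x)) \<partial>measure_pmf \<mu>) \<le> (\<integral>\<^sup>+x. ennreal (1 + t\<^sup>2 * K\<^sup>2 + t * D x) \<partial>measure_pmf \<mu>)"
  proof (rule nn_integral_mono_AE)
    show "AE x in measure_pmf \<mu>. ennreal (exp (t * D x)) \<le> ennreal (1 + t\<^sup>2 * K\<^sup>2 + t * D x)"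
      using D
    proof eventually_elim
      case (elim x)
      have "\<bar>t * D x\<bar> \<le> \<bar>t\<bar> * K" unfolding abs_mult using elim by (intro mult_left_mono) auto
      moreover from this have "\<bar>t * D x\<bar>\<^sup>2 \<le> (\<bar>t\<bar> * K)\<^sup>2" by (intro power_mono) auto
      ultimately show ?case
        using exp_le_quadratic[of "t * D x"] assms(1) by (intro ennreal_leI) (simp add: power_mult_distrib)
    qed
  qed
  also have "\<dots> = ennreal (\<integral>x. 1 + t\<^sup>2 * K\<^sup>2 + t * D x \<partial>measure_pmf \<mu>)"
  proof (rule nn_integral_eq_integral)
    show "AE x in measure_pmf \<mu>. 0 \<le> 1 + t\<^sup>2 * K\<^sup>2 + t * D x"
      using D
    proof eventually_elim
      case (elim x)
      have "\<bar>t * D x\<bar> \<le> \<bar>t\<bar> * K" unfolding abs_mult using elim by (intro mult_left_mono) auto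
      then have "\<bar>t * D x\<bar> \<le> 1" using assms(1) by linarith
      moreover have "0 \<le> t\<^sup>2 * K\<^sup>2" by simp
      ultimately show ?case by linarith
    qed
  qed (use iD in simp)
  also have "(\<integral>x. 1 + t\<^sup>2 * K\<^sup>2 + t * D x \<partial>measure_pmf \<mu>) = 1 + t\<^sup>2 * K\<^sup>2"
    using iD ED by simp
  finally show ?thesis by (simp add: D_def)
qed

text \<open>The induction peels off the first step, since integrals over streams unfold at the head;
  the starting state therefore has to vary.\<close>

lemma exp_moment_bound:
  assumes t: "\<bar>t\<bar> * K \<le> 1" and s: "s \<in> S"
  shows "(\<integral>\<^sup>+\<omega>. ennreal (exp (t * (h (foldl step s (stake n \<omega>)) - h s - real n * d)))
    \<partial>stream_space (measure_pmf \<mu>)) \<le> ennreal ((1 + t\<^sup>2 * K\<^sup>2) ^ n)"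
  using s
proof (induction n arbitrary: s)
  case 0
  interpret prob_space "stream_space (measure_pmf \<mu>)" by (rule prob_space_stream_pmf)
  show ?case by (simp add: emeasure_space_1)
next
  case (Suc n)
  let ?I = "\<lambda>s. \<integral>\<^sup>+\<omega>. ennreal (exp (t * (h (foldl step s (stake n \<omega>)) - h s - real n * d)))
    \<partial>stream_space (measure_pmf \<mu>)"
  let ?e = "\<lambda>x. ennreal (exp (t * (h (step s x) - h s - d)))"
  have "(\<integral>\<^sup>+\<omega>. ennreal (exp (t * (h (foldl step s (stake (Suc n) \<omega>)) - h s - real (Suc n) * d)))
      \<partial>stream_space (measure_pmf \<mu>)) =
    (\<integral>\<^sup>+x. (\<integral>\<^sup>+\<omega>. ennreal (exp (t * (h (foldl step s (stake (Suc n) (x ## \<omega>))) - h s - real (Suc n) * d)))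
      \<partial>stream_space (measure_pmf \<mu>)) \<partial>measure_pmf \<mu>)"
    by (rule prob_space.nn_integral_stream_space[OF prob_space_measure_pmf]) measurable
  also have "\<dots> = (\<integral>\<^sup>+x. ?e x * ?I (step s x) \<partial>measure_pmf \<mu>)"
    by (subst nn_integral_cmult[symmetric], measurable)
       (auto intro!: nn_integral_cong simp: ennreal_mult[symmetric] exp_add[symmetric] algebra_simps)
  also have "\<dots> \<le> (\<integral>\<^sup>+x. ?e x * ennreal ((1 + t\<^sup>2 * K\<^sup>2) ^ n) \<partial>measure_pmf \<mu>)"
    using Suc closed by (intro nn_integral_mono_AE) (auto simp: AE_measure_pmf_iff intro!: mult_left_mono)
  also have "\<dots> = (\<integral>\<^sup>+x. ?e x \<partial>measure_pmf \<mu>) * ennreal ((1 + t\<^sup>2 * K\<^sup>2) ^ n)"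
    by (rule nn_integral_multc) simp
  also have "\<dots> \<le> ennreal (1 + t\<^sup>2 * K\<^sup>2) * ennreal ((1 + t\<^sup>2 * K\<^sup>2) ^ n)"
    using exp_increment[OF t Suc.prems] by (intro mult_right_mono) auto
  also have "\<dots> = ennreal ((1 + t\<^sup>2 * K\<^sup>2) ^ Suc n)"
    by (simp add: ennreal_mult[symmetric] del: ennreal_plus)
  finally show ?case .
qed

text \<open>Chernoff bound and Borel-Cantelli; \<open>\<sigma>\<close> selects the upper or the
  lower tail.\<close>

lemma eventually_deviation_less:
  assumes s: "s \<in> S" and \<epsilon>: "0 < \<epsilon>" and \<sigma>: "\<sigma> \<in> {1, -1}"
  shows "AE \<omega> in stream_space (measure_pmf \<mu>).
    \<forall>\<^sub>F n in sequentially. \<sigma> * (h (foldl step s (stake n \<omega>)) - h s - real n * d) < \<epsilon> * real n"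
proof -
  interpret prob_space "stream_space (measure_pmf \<mu>)" by (rule prob_space_stream_pmf)
  \<comment> \<open>The first entry makes the moment bound applicable. The second gives
    \<open>t K^2 < \<epsilon>\<close>, hence \<open>1 + t^2 K^2 < exp (t \<epsilon>)\<close> and
    geometric tails.\<close>
  define t where "t = min (1 / K) (\<epsilon> / (2 * K\<^sup>2))"
  have t: "0 < t" "t * K \<le> 1"
    using K \<epsilon> by (auto simp: t_def min_def field_simps split: if_splits)
  have "t * K\<^sup>2 \<le> \<epsilon> / (2 * K\<^sup>2) * K\<^sup>2"
    by (intro mult_right_mono) (auto simp: t_def)
  also have "\<dots> < \<epsilon>" using K \<epsilon> by simp
  finally have tK: "t * K\<^sup>2 < \<epsilon>" .
  define q where "q = (1 + t\<^sup>2 * K\<^sup>2) * exp (- t * \<epsilon>)"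
  have "1 + t\<^sup>2 * K\<^sup>2 \<le> exp (t\<^sup>2 * K\<^sup>2)" by (rule exp_ge_add_one_self)
  also have "\<dots> < exp (t * \<epsilon>)"
    using t(1) tK by (simp add: power2_eq_square)
  finally have q: "0 < q" "q < 1"
    by (auto simp: q_def exp_minus field_simps intro!: mult_pos_pos add_pos_nonneg)
  define A where "A n = {\<omega> \<in> space (stream_space (measure_pmf \<mu>)).
    \<epsilon> * real n \<le> \<sigma> * (h (foldl step s (stake n \<omega>)) - h s - real n * d)}" for n
  have A [measurable]: "A n \<in> sets (stream_space (measure_pmf \<mu>))" for n
    unfolding A_def by measurable
  have "prob (A n) \<le> q ^ n" for n
  proof -
    let ?f = "\<lambda>\<omega>. ennreal (exp (t * \<sigma> * (h (foldl step s (stake n \<omega>)) - h s - real n * d)))"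
    have "emeasure (stream_space (measure_pmf \<mu>)) (A n) =
        (\<integral>\<^sup>+\<omega>. indicator (A n) \<omega> \<partial>stream_space (measure_pmf \<mu>))" by simp
    also have "\<dots> \<le> (\<integral>\<^sup>+\<omega>. ennreal (exp (- t * \<epsilon> * n)) * ?f \<omega> \<partial>stream_space (measure_pmf \<mu>))"
    proof (rule nn_integral_mono)
      fix \<omega>
      show "indicator (A n) \<omega> \<le> ennreal (exp (- t * \<epsilon> * n)) * ?f \<omega>"
      proof (cases "\<omega> \<in> A n")
        case True
        then have "t * (\<epsilon> * real n) \<le> t * (\<sigma> * (h (foldl step s (stake n \<omega>)) - h s - real n * d))"
          using t(1) by (intro mult_left_mono) (auto simp: A_def)
        then have "1 \<le> exp (- t * \<epsilon> * n + t * \<sigma> * (h (foldl step s (stake n \<omega>)) - h s - real n * d))"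
          by (simp add: mult.assoc)
        then show ?thesis
          using True by (simp add: ennreal_mult[symmetric] exp_add[symmetric])
      qed simp
    qed
    also have "\<dots> = ennreal (exp (- t * \<epsilon> * n)) * (\<integral>\<^sup>+\<omega>. ?f \<omega> \<partial>stream_space (measure_pmf \<mu>))"
      by (rule nn_integral_cmult) measurable
    also have "\<dots> \<le> ennreal (exp (- t * \<epsilon> * n)) * ennreal ((1 + (t * \<sigma>)\<^sup>2 * K\<^sup>2) ^ n)"
      using \<sigma> t by (intro mult_left_mono exp_moment_bound s) (auto simp: abs_mult)
    also have "\<dots> = ennreal (q ^ n)"
    proof -
      have "\<sigma>\<^sup>2 = 1" using \<sigma> by auto
      moreover have "exp (- t * \<epsilon> * n) = exp (- t * \<epsilon>) ^ n"
        by (simp add: exp_of_nat_mult[symmetric] mult_ac)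
      ultimately show ?thesis
        by (simp add: q_def power_mult_distrib ennreal_mult[symmetric] mult_ac)
    qed
    finally show ?thesis using q by (simp add: emeasure_eq_measure)
  qed
  then have "summable (\<lambda>n. prob (A n))"
    using q by (intro summable_comparison_test_ev[OF _ summable_geometric[of q]]) auto
  then have "AE \<omega> in stream_space (measure_pmf \<mu>).
      \<forall>\<^sub>F n in sequentially. \<omega> \<in> space (stream_space (measure_pmf \<mu>)) - A n"
    by (intro borel_cantelli_AE1) (auto simp: emeasure_eq_measure)
  then show ?thesis
    by eventually_elim (auto simp: A_def elim!: eventually_mono)
qed

text \<open>Serves twice: for the walk with \<open>corrected_potential\<close>, where the law of the
  increment depends on the state, and for i.i.d. exponents with their running sum as state.\<close>

theorem strong_law_bounded_increments:
  assumes s: "s \<in> S"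
  shows "AE \<omega> in stream_space (measure_pmf \<mu>). (\<lambda>n. h (foldl step s (stake n \<omega>)) / real n) \<longlonglongrightarrow> d"
proof -
  have "AE \<omega> in stream_space (measure_pmf \<mu>). \<forall>j::nat. \<forall>\<sigma>\<in>{1, -1}.
    \<forall>\<^sub>F n in sequentially. \<sigma> * (h (foldl step s (stake n \<omega>)) - h s - real n * d) < 1 / real (Suc j) * real n"
    unfolding AE_all_countable
    by (intro allI AE_finite_allI eventually_deviation_less s) auto
  then show ?thesis
  proof eventually_elim
    case (elim \<omega>)
    define X where "X n = h (foldl step s (stake n \<omega>)) - h s - real n * d" for n
    have "(\<lambda>n. X n / real n) \<longlonglongrightarrow> 0"
    proof (rule LIMSEQ_I)
      fix r :: real assume "0 < r"
      then obtain j where j: "1 / real (Suc j) < r" using nat_approx_posE by blast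
      have "\<forall>\<^sub>F n in sequentially. X n < 1 / real (Suc j) * real n"
        "\<forall>\<^sub>F n in sequentially. - X n < 1 / real (Suc j) * real n"
        using elim[rule_format, of 1 j] elim[rule_format, of "-1" j] by (simp_all add: X_def)
      then have "\<forall>\<^sub>F n in sequentially. norm (X n / real n - 0) < r"
        using eventually_gt_at_top[of 0]
      proof eventually_elim
        case (elim n)
        then have "\<bar>X n\<bar> < 1 / real (Suc j) * real n" by linarith
        also have "\<dots> < r * real n" using j elim by (intro mult_strict_right_mono) auto
        finally show ?case using elim by (simp add: abs_divide divide_less_eq)
      qed
      then show "\<exists>no. \<forall>n\<ge>no. norm (X n / real n - 0) < r" by (simp add: eventually_sequentially)
    qed
    moreover have "(\<lambda>n. h s / real n) \<longlonglongrightarrow> 0" by (rule lim_const_over_n)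
    ultimately have "(\<lambda>n. X n / real n + h s / real n + d) \<longlonglongrightarrow> 0 + 0 + d"
      by (intro tendsto_intros)
    moreover have "\<forall>\<^sub>F n in sequentially. X n / real n + h s / real n + d = h (foldl step s (stake n \<omega>)) / real n"
      using eventually_gt_at_top[of 0] by eventually_elim (simp add: X_def field_simps)
    ultimately show ?case by (simp add: tendsto_cong)
  qed
qed

end

lemma nn_integral_harmonic:
  fixes \<mu> :: "'a::countable pmf" and step :: "'s \<Rightarrow> 'a \<Rightarrow> 's"
  assumes closed: "\<And>s x. s \<in> S \<Longrightarrow> x \<in> set_pmf \<mu> \<Longrightarrow> step s x \<in> S"
    and bounded: "\<And>s. s \<in> S \<Longrightarrow> 0 \<le> \<Phi> s \<and> \<Phi> s \<le> (1::real)"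
    and mean: "\<And>s. s \<in> S \<Longrightarrow> measure_pmf.expectation \<mu> (\<lambda>x. \<Phi> (step s x)) = \<Phi> s"
    and "s \<in> S"
  shows "(\<integral>\<^sup>+\<omega>. ennreal (\<Phi> (foldl step s (stake n \<omega>))) \<partial>stream_space (measure_pmf \<mu>)) = ennreal (\<Phi> s)"
  using \<open>s \<in> S\<close>
proof (induction n arbitrary: s)
  case 0
  interpret prob_space "stream_space (measure_pmf \<mu>)" by (rule prob_space_stream_pmf)
  show ?case by (simp add: emeasure_space_1)
next
  case (Suc n)
  have "(\<integral>\<^sup>+\<omega>. ennreal (\<Phi> (foldl step s (stake (Suc n) \<omega>))) \<partial>stream_space (measure_pmf \<mu>)) =
    (\<integral>\<^sup>+x. (\<integral>\<^sup>+\<omega>. ennreal (\<Phi> (foldl step s (stake (Suc n) (x ## \<omega>)))) \<partial>stream_space (measure_pmf \<mu>)) \<partial>measure_pmf \<mu>)"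
    by (rule prob_space.nn_integral_stream_space[OF prob_space_measure_pmf]) measurable
  also have "\<dots> = (\<integral>\<^sup>+x. ennreal (\<Phi> (step s x)) \<partial>measure_pmf \<mu>)"
    using Suc closed by (intro nn_integral_cong_AE) (auto simp: AE_measure_pmf_iff)
  also have "\<dots> = ennreal (measure_pmf.expectation \<mu> (\<lambda>x. \<Phi> (step s x)))"
  proof (rule nn_integral_eq_integral)
    have "AE x in measure_pmf \<mu>. 0 \<le> \<Phi> (step s x) \<and> \<Phi> (step s x) \<le> 1"
      using bounded closed[OF Suc.prems] by (auto simp: AE_measure_pmf_iff)
    then show "AE x in measure_pmf \<mu>. 0 \<le> \<Phi> (step s x)" "integrable (measure_pmf \<mu>) (\<lambda>x. \<Phi> (step s x))"
      by (auto intro!: measure_pmf.integrable_const_bound[where B=1])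
  qed
  finally show ?case using mean[OF Suc.prems] by simp
qed

text \<open>The cylinders and the empty set form an intersection-stable generator. The empty word
  gives the whole space, on which probability measures agree.\<close>

lemma stream_measure_eqI_sstart:
  assumes S: "countable S" and P: "prob_space M" "prob_space N"
    and sets: "sets M = sets (stream_space (count_space S))" "sets N = sets (stream_space (count_space S))"
    and eq: "\<And>u. u \<in> lists S \<Longrightarrow> u \<noteq> [] \<Longrightarrow> emeasure M (sstart S u) = emeasure N (sstart S u)"
  shows "M = N"
proof (rule measure_eqI_generator_eq[where E="sstart S ` lists S \<union> {{}}" and \<Omega>="streams S" and A="\<lambda>_. streams S"])
  show "Int_stable (sstart S ` lists S \<union> {{}})" by (rule Int_stable_sstart)
  show E: "sstart S ` lists S \<union> {{}} \<subseteq> Pow (streams S)"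
    by (simp add: image_subset_iff sstart_in_streams)
  show "sets M = sigma_sets (streams S) (sstart S ` lists S \<union> {{}})"
    "sets N = sigma_sets (streams S) (sstart S ` lists S \<union> {{}})"
    unfolding sets sets_stream_space_sstart[OF S] using E by simp_all
  have sp: "space M = streams S" "space N = streams S"
    using sets[THEN sets_eq_imp_space_eq] by (simp_all add: space_stream_space)
  show "emeasure M X = emeasure N X" if "X \<in> sstart S ` lists S \<union> {{}}" for X
  proof -
    consider "X = {}" | u where "u \<in> lists S" "X = sstart S u" using \<open>X \<in> _\<close> by blast
    then show ?thesis
    proof cases
      case 2
      then show ?thesis
        using eq[of u] prob_space.emeasure_space_1[OF P(1)] prob_space.emeasure_space_1[OF P(2)]
        by (cases "u = []") (auto simp: sp)
    qed simp
  qed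
  show "range (\<lambda>_::nat. streams S) \<subseteq> sstart S ` lists S \<union> {{}}"
    by (auto intro!: image_eqI[of _ _ "[]"])
  show "emeasure M (streams S) \<noteq> \<infinity>"
    using prob_space.emeasure_space_1[OF P(1)] by (simp add: sp)
qed simp

section \<open>One step of the walk\<close>

fun other :: "factor \<Rightarrow> factor" where
  "other FacA = FacB"
| "other FacB = FacA"

lemma other_neq [simp]: "other f \<noteq> f" "f \<noteq> other f"
  by (cases f; simp)+

lemma other_other [simp]: "other (other f) = f"
  by (cases f) auto

lemma factor_neq_iff: "f \<noteq> g \<longleftrightarrow> g = other f"
  by (cases f; cases g) auto

text \<open>The exponents \<open>0\<close> and \<open>k\<close> both stand for the identity, so that
  moving an exponent by one needs no case split at the ends.\<close>

definition syllable :: "nat \<Rightarrow> factor \<Rightarrow> nat \<Rightarrow> letter list" where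
  "syllable k f i = (if i = 0 \<or> i = k then [] else [(f, i)])"

definition weight :: "nat \<Rightarrow> nat \<Rightarrow> real" where
  "weight k i = F i (root_F k)"

definition word_weight :: "nat \<Rightarrow> letter list \<Rightarrow> real" where
  "word_weight k w = (\<Prod>u\<leftarrow>w. weight k (snd u))"

definition potential :: "nat \<Rightarrow> letter list \<Rightarrow> real" where
  "potential k w = (\<Sum>u\<leftarrow>w. real (snd u * (k - snd u)))"

definition step_mean :: "nat \<Rightarrow> (letter list \<Rightarrow> real) \<Rightarrow> letter list \<Rightarrow> real" where
  "step_mean k \<Phi> g = measure_pmf.expectation (simple_step k) (\<lambda>x. \<Phi> (word_mult k g x))"

text \<open>
  \<open>hit k u g\<close> is the probability that the walk started at \<open>g\<close> converges to an end in the
  cylinder of \<open>u\<close>, for \<open>u \<noteq> []\<close>.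
\<close>
fun hit :: "nat \<Rightarrow> letter list \<Rightarrow> letter list \<Rightarrow> real" where
  "hit k [] g = 1"
| "hit k (u # us) [] = word_weight k (u # us) / 2"
| "hit k (u # us) (v # vs) =
    (if fst u \<noteq> fst v then word_weight k (v # vs) * word_weight k (u # us) / 2
     else if u = v then (if us = [] then 1 - word_weight k vs / 2 else hit k us vs)
     else word_weight k vs * weight k (if snd u < snd v then snd v - snd u else snd u - snd v)
       * word_weight k us / 2)"

lemma word_weight_simps [simp]:
  "word_weight k [] = 1" "word_weight k (u # w) = weight k (snd u) * word_weight k w"
  by (simp_all add: word_weight_def)

lemma potential_simps [simp]:
  "potential k [] = 0" "potential k (u # w) = real (snd u * (k - snd u)) + potential k w"
  by (simp_all add: potential_def)

text \<open>\<open>word_mult\<close> is built from left multiplications, while the walk multiplies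
  on the right. As long as a letter is left, the first one keeps its factor, so a letter placed in
  front cannot merge with the product.\<close>

lemma word_mult_letter_hd:
  assumes "vs \<in> reduced_words k" "vs \<noteq> []"
  shows "word_mult k vs [x] = [] \<or> fst (hd (word_mult k vs [x])) = fst (hd vs)"
  using assms
proof (induction vs)
  case (Cons v vs)
  show ?case
  proof (cases "vs = []")
    case True
    then show ?thesis by (simp add: word_mult_def)
  next
    case False
    then have "word_mult k vs [x] = [] \<or> fst (hd (word_mult k vs [x])) = fst (hd vs)"
      using Cons by (simp add: reduced_words_Cons)
    moreover have "fst v \<noteq> fst (hd vs)"
      using Cons.prems False by (simp add: reduced_words_Cons)
    ultimately show ?thesis
      by (cases "word_mult k vs [x]") (auto simp: word_mult_def)
  qed
qed simp

lemma word_mult_Cons_letter: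
  assumes "v # vs \<in> reduced_words k" "vs \<noteq> []"
  shows "word_mult k (v # vs) [x] = v # word_mult k vs [x]"
proof -
  have "word_mult k vs [x] = [] \<or> fst (hd (word_mult k vs [x])) = fst (hd vs)"
    using assms by (intro word_mult_letter_hd) (auto simp: reduced_words_Cons)
  moreover have "fst v \<noteq> fst (hd vs)"
    using assms by (simp add: reduced_words_Cons)
  ultimately show ?thesis
    by (cases "word_mult k vs [x]") (auto simp: word_mult_def)
qed

text \<open>A step may change the exponent of the last letter without changing the length, so the
  guaranteed common prefix is one letter shorter than \<open>g\<close>.\<close>

lemma word_mult_letter_length:
  assumes "g \<in> reduced_words k"
  shows "length (word_mult k g [x]) \<le> Suc (length g) \<and> length g \<le> Suc (length (word_mult k g [x])) \<and>
    take (length g - 1) (word_mult k g [x]) = take (length g - 1) g"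
  using assms
proof (induction g)
  case (Cons v g)
  show ?case
  proof (cases "g = []")
    case True
    then show ?thesis by (simp add: word_mult_def)
  next
    case False
    then show ?thesis
      using Cons word_mult_Cons_letter[OF Cons.prems False, of x]
      by (cases g) (auto simp: reduced_words_Cons)
  qed
qed (simp add: word_mult_def)

lemma Cons_reduced_cases:
  assumes "v # g \<in> reduced_words k"
  obtains "0 < snd v" "snd v < k" "g \<in> reduced_words k"
  using assms by (auto simp: reduced_words_Cons letters_iff)

context
  fixes k :: nat
  assumes k: "3 \<le> k"
begin

lemma simple_step_alt:
  "simple_step k = pmf_of_set {[(FacA, 1)], [(FacA, k - 1)], [(FacB, 1)], [(FacB, k - 1)]}"
  using k inv_gen[of k FacA] inv_gen[of k FacB]
  by (simp add: simple_step_def gen_a_def gen_b_def)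

lemma set_simple_step:
  "set_pmf (simple_step k) = {[(FacA, 1)], [(FacA, k - 1)], [(FacB, 1)], [(FacB, k - 1)]}"
  unfolding simple_step_alt by (rule set_pmf_of_set) auto

lemma simple_step_letter:
  assumes "x \<in> set_pmf (simple_step k)"
  obtains u where "u \<in> letters k" "x = [u]"
  using assms k by (auto simp: set_simple_step letters_iff)

text \<open>The free parameter \<open>f\<close> allows the four neighbours to be grouped by the
  factor of the last letter.\<close>

lemma step_mean_alt:
  "step_mean k \<Phi> g = (\<Phi> (word_mult k g [(f, 1)]) + \<Phi> (word_mult k g [(f, k - 1)]) +
     \<Phi> (word_mult k g [(other f, 1)]) + \<Phi> (word_mult k g [(other f, k - 1)])) / 4"
proof -
  have "card {[(FacA, 1)], [(FacA, k - 1)], [(FacB, 1)], [(FacB, k - 1)]} = 4"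
    using k by auto
  then show ?thesis
    unfolding step_mean_def simple_step_alt
    using k by (subst integral_pmf_of_set) (cases f; auto)+
qed

lemma step_mean_Nil:
  "step_mean k \<Phi> [] = (\<Phi> [(f, 1)] + \<Phi> [(f, k - 1)] + \<Phi> [(other f, 1)] + \<Phi> [(other f, k - 1)]) / 4"
  by (simp add: step_mean_alt[of _ _ f] word_mult_def)

lemma step_mean_single:
  assumes "0 < i" "i < k"
  shows "step_mean k \<Phi> [(f, i)] = (\<Phi> [(f, i), (other f, 1)] + \<Phi> [(f, i), (other f, k - 1)] +
    \<Phi> (syllable k f (i + 1)) + \<Phi> (syllable k f (i - 1))) / 4"
proof -
  have "(i + (k - 1)) mod k = i - 1"
  proof -
    have e: "i + (k - 1) = (i - 1) + k" using assms by simp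
    show ?thesis unfolding e using assms by (simp only: mod_add_self2) simp
  qed
  moreover have "(i + 1) mod k = (if i + 1 = k then 0 else i + 1)"
    using assms by auto
  moreover have "i - 1 \<noteq> k" using assms by simp
  ultimately show ?thesis
    using assms by (simp add: step_mean_alt[of _ _ f] word_mult_def syllable_def)
qed

text \<open>The head is a spectator while something follows it; this reduces mean value identities
  to words of one letter.\<close>

lemma step_mean_Cons:
  assumes "v # g \<in> reduced_words k" "g \<noteq> []"
  shows "step_mean k \<Phi> (v # g) = step_mean k (\<lambda>w. \<Phi> (v # w)) g"
  by (simp add: step_mean_alt[of _ _ FacA] word_mult_Cons_letter[OF assms])

lemma step_mean_cmult: "step_mean k (\<lambda>g. c * \<Phi> g) g = c * step_mean k \<Phi> g"
  by (simp add: step_mean_alt[of _ _ FacA] algebra_simps)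

lemma step_mean_add: "step_mean k (\<lambda>g. \<Phi> g + \<Psi> g) g = step_mean k \<Phi> g + step_mean k \<Psi> g"
  by (simp add: step_mean_alt[of _ _ FacA] add_divide_distrib)

lemma step_mean_const: "step_mean k (\<lambda>g. c) g = c"
  by (simp add: step_mean_alt[of _ _ FacA])

lemma weight_simps:
  "weight k 0 = 1" "weight k k = 1" "weight k (Suc 0) = root_F k" "weight k (k - Suc 0) = root_F k"
  using root_F[OF k] F_root_symmetric[OF k, of 1] k by (auto simp: weight_def)

lemma weight_pos: "0 < weight k i"
  using F_root_pos[OF k] by (simp add: weight_def)

lemma weight_symmetric: "i \<le> k \<Longrightarrow> weight k (k - i) = weight k i"
  using F_root_symmetric[OF k] by (simp add: weight_def)

lemma weight_harmonic:
  "0 < i \<Longrightarrow> weight k (i - 1) + weight k (i + 1) = 2 * (2 - root_F k) * weight k i"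
  using F_root_harmonic[OF k] by (simp add: weight_def)

lemma sum_weight: "(\<Sum>i=1..<k. weight k i) = 1"
  using sum_F_root[OF k] by (simp add: weight_def)

lemma weight_less_1:
  assumes "0 < i" "i < k"
  shows "weight k i < 1"
proof -
  \<comment> \<open>A second exponent beside \<open>i\<close>; it lies below \<open>k\<close>
    because \<open>k \<ge> 3\<close>.\<close>
  define j :: nat where "j = (if i = 1 then 2 else 1)"
  have "weight k i + weight k j = (\<Sum>l\<in>{i, j}. weight k l)"
    by (simp add: j_def)
  also have "\<dots> \<le> (\<Sum>l=1..<k. weight k l)"
    using assms k weight_pos by (intro sum_mono2) (auto simp: j_def less_imp_le)
  finally show ?thesis using weight_pos[of j] sum_weight by simp
qed

lemma word_weight_bounds:
  assumes "w \<in> reduced_words k"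
  shows "0 < word_weight k w \<and> word_weight k w \<le> 1"
  using assms
proof (induction w)
  case (Cons u w)
  then show ?case
    using weight_pos[of "snd u"] weight_less_1[of "snd u"]
    by (auto elim!: Cons_reduced_cases intro!: mult_le_one)
qed simp

lemma word_weight_syllable: "i \<le> k \<Longrightarrow> word_weight k (syllable k f i) = weight k i"
  by (auto simp: syllable_def weight_simps)

lemma potential_syllable: "i \<le> k \<Longrightarrow> potential k (syllable k f i) = real (i * (k - i))"
  by (auto simp: syllable_def)

text \<open>For one letter the neighbours contribute \<open>2 x p_i + p_(i-1) + p_(i+1)\<close>,
  which the recurrence turns into \<open>4 p_i\<close>.\<close>

lemma step_mean_word_weight:
  assumes "g \<in> reduced_words k" "g \<noteq> []"
  shows "step_mean k (word_weight k) g = word_weight k g"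
  using assms
proof (induction g)
  case (Cons v g)
  show ?case
  proof (cases "g = []")
    case True
    obtain f i where v: "v = (f, i)" by force
    then have i: "0 < i" "i < k" using Cons.prems by (auto simp: reduced_words_Cons letters_iff)
    have "weight k (i + 1) + weight k (i - 1) = 2 * (2 - root_F k) * weight k i"
      using weight_harmonic[of i] i by simp
    then show ?thesis
      using True i by (simp add: v step_mean_single word_weight_syllable weight_simps algebra_simps)
  next
    case False
    then show ?thesis
      using Cons by (simp add: step_mean_Cons step_mean_cmult reduced_words_Cons)
  qed
qed simp

lemma step_mean_word_weight_Nil: "step_mean k (word_weight k) [] = root_F k"
  by (simp add: step_mean_Nil[of _ FacA] weight_simps)

text \<open>The two moves into the other factor add \<open>k - 1\<close> each, and the two moves of
  the last exponent together add the second difference \<open>-2\<close>; a quarter of the total is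
  \<open>(k - 2) / 2\<close>.\<close>

lemma step_mean_potential:
  assumes "g \<in> reduced_words k" "g \<noteq> []"
  shows "step_mean k (potential k) g = potential k g + (real k - 2) / 2"
  using assms
proof (induction g)
  case (Cons v g)
  show ?case
  proof (cases "g = []")
    case True
    obtain f i where v: "v = (f, i)" by force
    then have i: "0 < i" "i < k" using Cons.prems by (auto simp: reduced_words_Cons letters_iff)
    have "real ((i + 1) * (k - (i + 1))) + real ((i - 1) * (k - (i - 1))) = 2 * real (i * (k - i)) - 2"
    proof -
      have e: "real (i + 1) = real i + 1" "real (k - (i + 1)) = real k - real i - 1"
        "real (i - 1) = real i - 1" "real (k - (i - 1)) = real k - real i + 1" "real (k - i) = real k - real i"
        using i by (auto simp: of_nat_diff)
      show ?thesis unfolding of_nat_mult e by (simp add: algebra_simps)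
    qed
    then show ?thesis
      using True i k by (simp add: v step_mean_single potential_syllable of_nat_diff field_simps del: of_nat_mult)
  next
    case False
    then show ?thesis
      using Cons by (simp add: step_mean_Cons step_mean_add step_mean_const reduced_words_Cons)
  qed
qed simp

lemma step_mean_potential_Nil: "step_mean k (potential k) [] = real k - 1"
  using k by (simp add: step_mean_Nil[of _ FacA] of_nat_diff)

text \<open>The second term cancels the excess \<open>k / 2\<close> of the mean increment at the identity.\<close>
definition corrected_potential :: "letter list \<Rightarrow> real" where
  "corrected_potential g = potential k g + real k / 2 / (1 - root_F k) * word_weight k g"

lemma step_mean_corrected_potential:
  assumes "g \<in> reduced_words k"
  shows "step_mean k corrected_potential g = corrected_potential g + (real k - 2) / 2"
proof -
  have e: "step_mean k corrected_potential g =
      step_mean k (potential k) g + real k / 2 / (1 - root_F k) * step_mean k (word_weight k) g"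
    unfolding corrected_potential_def by (simp only: step_mean_add step_mean_cmult)
  show ?thesis
  proof (cases "g = []")
    case True
    then show ?thesis
      unfolding e using root_F[OF k]
      by (simp add: corrected_potential_def step_mean_potential_Nil step_mean_word_weight_Nil field_simps)
  next
    case False
    then show ?thesis
      unfolding e using assms
      by (simp add: corrected_potential_def step_mean_potential step_mean_word_weight)
  qed
qed

lemma potential_bounds:
  assumes "w \<in> reduced_words k"
  shows "real (length w) \<le> potential k w" "potential k w \<le> real (k * k) * length w"
proof -
  have "real (length w) \<le> potential k w \<and> potential k w \<le> real (k * k) * length w"
    using assms
  proof (induction w)
    case (Cons u w)
    then have u: "0 < snd u" "snd u < k" "w \<in> reduced_words k"
      by (auto simp: reduced_words_Cons letters_iff)
    have "1 \<le> snd u * (k - snd u)" "snd u * (k - snd u) \<le> k * k"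
      using u by (auto simp: Suc_le_eq intro!: mult_le_mono)
    then have "1 \<le> real (snd u * (k - snd u))" "real (snd u * (k - snd u)) \<le> real (k * k)"
      using of_nat_le_iff[where 'a=real] by (metis of_nat_1, blast)
    then show ?case
      using Cons.IH[OF u(3)] by (simp add: algebra_simps del: of_nat_mult)
  qed simp
  then show "real (length w) \<le> potential k w" "potential k w \<le> real (k * k) * length w" by auto
qed

lemma potential_increment:
  assumes "g \<in> reduced_words k" "u \<in> letters k"
  shows "\<bar>potential k (word_mult k g [u]) - potential k g\<bar> \<le> 2 * real (k * k)"
  using assms(1)
proof (induction g)
  case Nil
  have "[u] \<in> reduced_words k" using assms by (simp add: reduced_words_Cons)
  from potential_bounds[OF this] show ?case
    by (simp add: word_mult_def del: of_nat_mult)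
next
  case (Cons v g)
  show ?case
  proof (cases "g = []")
    case True
    have "word_mult k [v] [u] \<in> reduced_words k"
      using Cons.prems assms(2) True by (intro word_mult_closed) (auto simp: reduced_words_Cons)
    from potential_bounds[OF this] have
      "0 \<le> potential k (word_mult k [v] [u])" "potential k (word_mult k [v] [u]) \<le> 2 * real (k * k)"
    proof -
      assume a: "real (length (word_mult k [v] [u])) \<le> potential k (word_mult k [v] [u])"
        "potential k (word_mult k [v] [u]) \<le> real (k * k) * real (length (word_mult k [v] [u]))"
      show "0 \<le> potential k (word_mult k [v] [u])"
        using a(1) of_nat_0_le_iff order_trans by blast
      have "length (word_mult k [v] [u]) \<le> 2" by (simp add: word_mult_def)
      then have "real (k * k) * real (length (word_mult k [v] [u])) \<le> real (k * k) * 2"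
        by (intro mult_left_mono) auto
      then show "potential k (word_mult k [v] [u]) \<le> 2 * real (k * k)" using a(2) by linarith
    qed
    moreover have "0 \<le> potential k [v]" "potential k [v] \<le> 2 * real (k * k)"
      using potential_bounds[of "[v]"] Cons.prems True by (simp_all del: of_nat_mult potential_simps)
    ultimately show ?thesis using True by (simp del: of_nat_mult potential_simps)
  next
    case False
    then show ?thesis
      using Cons word_mult_Cons_letter[OF Cons.prems False] by (simp add: reduced_words_Cons del: of_nat_mult)
  qed
qed

section \<open>Harmonicity of \<open>hit\<close>\<close>

text \<open>The weight of the distance between \<open>i\<close> and \<open>j\<close> covers all
  exponents uniformly: \<open>i = j\<close> because \<open>weight k 0 = 1\<close>, and the identity,
  as \<open>i = 0\<close> or \<open>i = k\<close>, by symmetry of the weights.\<close>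

lemma weight_dist_syllable:
  assumes "0 < j" "j < k" "i \<le> k"
  shows "hit k ((f, j) # us) (syllable k f i) =
    weight k (if j < i then i - j else j - i) * word_weight k us / 2"
  using assms weight_symmetric[of j]
  by (cases us) (auto simp: syllable_def weight_simps)

text \<open>The recurrence translated by \<open>j\<close>. At \<open>i = j\<close> the distance has
  a kink and the identity fails, so \<open>hit_harmonic\<close> treats that letter
  separately.\<close>

lemma weight_dist_harmonic:
  assumes "0 < j" "j < k" "0 < i" "i < k" "i \<noteq> j"
  shows "weight k (if j < i + 1 then i + 1 - j else j - (i + 1)) +
    weight k (if j < i - 1 then i - 1 - j else j - (i - 1)) =
    2 * (2 - root_F k) * weight k (if j < i then i - j else j - i)"
proof (cases "j < i")
  case True
  then show ?thesis
    using weight_harmonic[of "i - j"] assms by (auto simp: Suc_diff_le)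
next
  case False
  then have "j - i + 1 = j - (i - 1)" "j - i - 1 = j - (i + 1)" using assms by auto
  then show ?thesis
    using weight_harmonic[of "j - i"] False assms by auto
qed

text \<open>The two moves into the factor of \<open>u\<close> change the exponent still missing to
  \<open>j - 1\<close> and \<open>j + 1\<close>, the other two cost a factor \<open>x\<close>; the
  recurrence at \<open>j\<close> balances them.\<close>

lemma hit_harmonic_Nil:
  assumes "u \<in> reduced_words k" "u \<noteq> []"
  shows "step_mean k (hit k u) [] = hit k u []"
proof -
  obtain f j us where u: "u = (f, j) # us" using assms by (metis neq_Nil_conv surj_pair)
  then have j: "0 < j" "j < k" using assms by (auto simp: reduced_words_Cons letters_iff)
  have "[(f, 1)] = syllable k f 1" "[(f, k - 1)] = syllable k f (k - 1)"
    using k by (auto simp: syllable_def)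
  then have e: "hit k u [(f, 1)] = weight k (j - 1) * word_weight k us / 2"
    "hit k u [(f, k - 1)] = weight k (j + 1) * word_weight k us / 2"
    using weight_dist_syllable[OF j, of 1 f us] weight_dist_syllable[OF j, of "k - 1" f us] j k
      weight_symmetric[of "j + 1"] unfolding u by (auto simp: weight_simps)
  have "weight k (j - 1) * word_weight k us + weight k (j + 1) * word_weight k us =
      (2 * (2 - root_F k) * weight k j) * word_weight k us"
    using weight_harmonic[OF j(1)] by (metis distrib_right)
  then show ?thesis
    unfolding step_mean_Nil[of _ f] e by (simp add: u weight_simps algebra_simps)
qed

text \<open>The induction strips common heads. For a longer \<open>g\<close> that leaves the target
  or completes it, \<open>hit\<close> is an affine function of the \<open>word_weight\<close> of the
  part to be erased. For one letter the recurrence, its translate or the value at the identity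
  applies.\<close>

lemma hit_harmonic:
  assumes "g \<in> reduced_words k" "u \<in> reduced_words k" "u \<noteq> []"
  shows "step_mean k (hit k u) g = hit k u g"
  using assms
proof (induction g arbitrary: u)
  case Nil
  then show ?case by (intro hit_harmonic_Nil)
next
  case (Cons v g)
  obtain f j us where u: "u = (f, j) # us" using Cons.prems by (metis neq_Nil_conv surj_pair)
  have j: "0 < j" "j < k" and us: "us \<in> reduced_words k"
    and us_f: "us = [] \<or> fst (hd us) \<noteq> f"
    using Cons.prems by (auto simp: u reduced_words_Cons letters_iff)
  obtain e i where v: "v = (e, i)" by force
  have i: "0 < i" "i < k" and g: "g \<in> reduced_words k"
    using Cons.prems by (auto simp: v reduced_words_Cons letters_iff)
  show ?case
  proof (cases "g = []")
    case False
    consider "f \<noteq> e" | "f = e" "i \<noteq> j" | "u = v # us" by (auto simp: u v)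
    then show ?thesis
    proof cases
      case 1
      then show ?thesis
        using False Cons.prems g step_mean_cmult[of "weight k i * word_weight k u / 2" "word_weight k" g]
        by (simp add: u v step_mean_Cons step_mean_word_weight mult_ac)
    next
      case 2
      define c where "c = weight k (if j < i then i - j else j - i) * word_weight k us / 2"
      have "hit k u (v # w) = c * word_weight k w" for w
        using 2 by (simp add: u v c_def)
      then show ?thesis
        using False Cons.prems g by (simp add: step_mean_Cons step_mean_cmult step_mean_word_weight)
    next
      case 3
      show ?thesis
      proof (cases "us = []")
        case True
        then show ?thesis
          using 3 False Cons.prems g step_mean_cmult[of "- 1 / 2" "word_weight k" g]
            step_mean_add[of "\<lambda>g. 1" "\<lambda>g. - 1 / 2 * word_weight k g" g]
          by (simp add: step_mean_Cons step_mean_word_weight step_mean_const)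
      next
        case us': False
        then show ?thesis
          using 3 False Cons.prems g us Cons.IH[OF g us us'] by (simp add: step_mean_Cons)
      qed
    qed
  next
    case True
    show ?thesis
    proof (cases "f = e")
      case False
      then have e: "e = other f" using factor_neq_iff by blast
      have syl: "hit k u (syllable k e l) = weight k l * word_weight k u / 2" if "l \<le> k" for l
        using that False by (auto simp: u syllable_def weight_simps)
      have hit: "hit k u ((e, l) # vs) = weight k l * word_weight k vs * word_weight k u / 2" for l vs
        using False by (simp add: u)
      have "weight k (i - 1) * word_weight k u + weight k (i + 1) * word_weight k u =
          2 * (2 - root_F k) * weight k i * word_weight k u"
        using weight_harmonic[OF i(1)] by (metis distrib_right)
      then show ?thesis
        unfolding True v step_mean_single[OF i] hit using i
        by (simp add: syl weight_simps algebra_simps)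
    next
      case f: True
      show ?thesis
      proof (cases "i = j")
        case False
        define D where "D l = weight k (if j < l then l - j else j - l)" for l
        have hit: "hit k u ((e, i) # vs) = word_weight k vs * D i * word_weight k us / 2" for vs
          using False f by (simp add: u D_def)
        have syl: "hit k u (syllable k e l) = D l * word_weight k us / 2" if "l \<le> k" for l
          using weight_dist_syllable[OF j that] f by (simp add: u D_def)
        have "D (i + 1) + D (i - 1) = 2 * (2 - root_F k) * D i"
          using weight_dist_harmonic[OF j i False] by (simp only: D_def)
        then have "D (i + 1) * word_weight k us + D (i - 1) * word_weight k us =
            2 * (2 - root_F k) * D i * word_weight k us"
          by (metis distrib_right)
        then show ?thesis
          unfolding True v step_mean_single[OF i] hit using i
          by (simp add: syl weight_simps algebra_simps)
      next
        case ij: True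
        have s: "hit k u (syllable k e (i + 1)) = root_F k * word_weight k us / 2"
          "hit k u (syllable k e (i - 1)) = root_F k * word_weight k us / 2"
          using weight_dist_syllable[OF j, of "i + 1" f us] weight_dist_syllable[OF j, of "i - 1" f us] i
          by (auto simp: u f ij weight_simps)
        show ?thesis
        proof (cases "us = []")
          case us: True
          then show ?thesis
            unfolding True v step_mean_single[OF i] s
            by (simp add: u f ij weight_simps del: word_weight_simps(2)) (simp add: weight_simps)
        next
          case us': False
          then obtain w0 ws where w0: "us = w0 # ws" by (cases us) auto
          define l where "l = snd w0"
          have "fst w0 = other f" using us_f factor_neq_iff[of f "fst w0"] by (auto simp: w0)
          then have us2: "us = (other f, l) # ws" unfolding w0 l_def by (cases w0) simp
          \<comment> \<open>Moving away from the letter \<open>v\<close> inside its factor has the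
            same value as entering factor \<open>f\<close> from the identity with target
            \<open>us\<close>, so the mean at \<open>v\<close> is the mean of
            \<open>hit k us\<close> at the identity.\<close>
          have "hit k us [(f, 1)] = root_F k * word_weight k us / 2"
            "hit k us [(f, k - 1)] = root_F k * word_weight k us / 2"
            by (simp_all add: us2 weight_simps)
          moreover have "step_mean k (hit k us) [] = hit k us []"
            using us us' by (rule hit_harmonic_Nil)
          ultimately have "hit k us [(other f, 1)] + hit k us [(other f, k - 1)] + root_F k * word_weight k us
              = 4 * hit k us []"
            unfolding step_mean_Nil[of _ f] by simp
          moreover have "hit k u ((e, i) # vs) = hit k us vs" for vs
            using us' by (simp add: u f ij)
          ultimately show ?thesis
            unfolding True v step_mean_single[OF i] s f by simp
        qed
      qed
    qed
  qed
qed

end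

section \<open>The limit of the walk and its law\<close>

instance factor :: countable
  by countable_datatype

lemma converges_to_endI:
  assumes "\<And>m. \<forall>\<^sub>F n in sequentially. m \<le> length (w n) \<and> take m (w n) = stake m \<xi>"
  shows "converges_to_end w \<xi>"
  unfolding converges_to_end_def filterlim_at_top
proof
  fix m
  show "\<forall>\<^sub>F n in sequentially. m \<le> common_prefix_length (w n) \<xi>"
    using assms[of m]
  proof eventually_elim
    case (elim n)
    have "finite {m. m \<le> length (w n) \<and> take m (w n) = stake m \<xi>}"
      by (rule finite_subset[of _ "{..length (w n)}"]) auto
    then show ?case
      unfolding common_prefix_length_def using elim by (intro Max_ge) auto
  qed
qed

lemma converges_to_endD:
  assumes "converges_to_end w \<xi>"
  shows "\<forall>\<^sub>F n in sequentially. m \<le> length (w n) \<and> take m (w n) = stake m \<xi>"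
proof -
  have "\<forall>\<^sub>F n in sequentially. m \<le> common_prefix_length (w n) \<xi>"
    using assms unfolding converges_to_end_def filterlim_at_top by blast
  then show ?thesis
  proof eventually_elim
    case (elim n)
    let ?A = "{m. m \<le> length (w n) \<and> take m (w n) = stake m \<xi>}"
    have "finite ?A" by (rule finite_subset[of _ "{..length (w n)}"]) auto
    moreover have "0 \<in> ?A" by simp
    ultimately have "Max ?A \<in> ?A" by (intro Max_in) blast+
    then have c: "common_prefix_length (w n) \<xi> \<le> length (w n)"
      "take (common_prefix_length (w n) \<xi>) (w n) = stake (common_prefix_length (w n) \<xi>) \<xi>"
      by (auto simp: common_prefix_length_def)
    have "take m (w n) = take m (take (common_prefix_length (w n) \<xi>) (w n))"
      using elim by (simp add: min_def)
    also have "\<dots> = stake m \<xi>" unfolding c(2) using elim by (simp add: take_stake min_def)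
    finally show ?case using elim c(1) by simp
  qed
qed

lemma converges_to_end_unique:
  assumes "converges_to_end w \<xi>" "converges_to_end w \<zeta>"
  shows "\<xi> = \<zeta>"
proof -
  have "\<xi> !! j = \<zeta> !! j" for j
  proof -
    have "\<forall>\<^sub>F n in sequentially. stake (Suc j) \<xi> = stake (Suc j) \<zeta>"
      using converges_to_endD[OF assms(1), of "Suc j"] converges_to_endD[OF assms(2), of "Suc j"]
      by eventually_elim metis
    then have "stake (Suc j) \<xi> = stake (Suc j) \<zeta>" by simp
    then show ?thesis by (metis lessI stake_nth)
  qed
  then have "smap id \<xi> = \<zeta>" by (subst smap_alt) simp
  then show ?thesis by (simp add: stream.map_id)
qed

lemma sstart_iff_stake: "\<xi> \<in> streams S \<Longrightarrow> \<xi> \<in> sstart S u \<longleftrightarrow> stake (length u) \<xi> = u"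
  by (auto simp: sstart_eq list_eq_iff_nth_eq)

lemma walk_foldl: "walk k \<omega> n = foldl (word_mult k) [] (stake n \<omega>)"
  by (induction n) (simp_all add: free_product_def stake_Suc del: stake.simps(2))

text \<open>The default value is itself a letter, so \<open>limit_end\<close> is a word over
  \<open>letters k\<close> even on the exceptional null set.\<close>

definition letter_at :: "nat \<Rightarrow> letter list stream \<Rightarrow> nat \<Rightarrow> nat \<Rightarrow> letter" where
  "letter_at k \<omega> j n = (if j < length (walk k \<omega> n) \<and> walk k \<omega> n ! j \<in> letters k
     then walk k \<omega> n ! j else (FacA, 1))"

text \<open>Each letter is read at the first time from which it stays constant; a
  \<open>LEAST\<close> over countably many measurable conditions keeps the map measurable.\<close>

definition limit_end :: "nat \<Rightarrow> letter list stream \<Rightarrow> letter stream" where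
  "limit_end k \<omega> =
     to_stream (\<lambda>j. letter_at k \<omega> j (LEAST N. \<forall>n\<ge>N. letter_at k \<omega> j n = letter_at k \<omega> j N))"

lemma letter_at_measurable [measurable]:
  "(\<lambda>\<omega>. letter_at k \<omega> j n) \<in> measurable (stream_space (measure_pmf \<mu>)) (count_space UNIV)"
  unfolding letter_at_def walk_foldl by (rule measurable_compose[OF measurable_stake_pmf]) simp

lemma limit_end_measurable:
  assumes "2 \<le> k"
  shows "limit_end k \<in> measurable (step_space \<mu>) (word_space k)"
  unfolding word_space_def step_space_def
proof (rule measurable_stream_space2)
  fix j
  have [measurable]: "Measurable.pred (stream_space (measure_pmf \<mu>))
      (\<lambda>\<omega>. letter_at k \<omega> j n = letter_at k \<omega> j N)" for n N
  proof -
    have [measurable]: "Measurable.pred (stream_space (measure_pmf \<mu>)) (\<lambda>\<omega>. letter_at k \<omega> j n = v)" for n v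
      by (rule measurable_compose[OF letter_at_measurable]) simp
    have e: "letter_at k \<omega> j n = letter_at k \<omega> j N \<longleftrightarrow> (\<exists>v. letter_at k \<omega> j n = v \<and> letter_at k \<omega> j N = v)" for \<omega>
      by auto
    show ?thesis unfolding e by measurable
  qed
  have "(\<lambda>\<omega>. letter_at k \<omega> j (LEAST N. \<forall>n\<ge>N. letter_at k \<omega> j n = letter_at k \<omega> j N))
      \<in> measurable (stream_space (measure_pmf \<mu>)) (count_space UNIV)"
    by (rule measurable_compose_countable[where f="\<lambda>N \<omega>. letter_at k \<omega> j N"]) measurable
  moreover have "letter_at k \<omega> j n \<in> letters k" for \<omega> n
    using assms by (simp add: letter_at_def letters_iff)
  ultimately have "(\<lambda>\<omega>. letter_at k \<omega> j (LEAST N. \<forall>n\<ge>N. letter_at k \<omega> j n = letter_at k \<omega> j N))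
      \<in> measurable (stream_space (measure_pmf \<mu>)) (count_space (letters k))"
    unfolding measurable_count_space_eq2_countable
    by auto
  then show "(\<lambda>\<omega>. limit_end k \<omega> !! j) \<in> measurable (stream_space (measure_pmf \<mu>)) (count_space (letters k))"
    by (simp add: limit_end_def to_stream_def)
qed

context
  fixes k :: nat
  assumes k: "3 \<le> k"
begin

lemma word_mult_closed_step:
  "g \<in> reduced_words k \<Longrightarrow> x \<in> set_pmf (simple_step k) \<Longrightarrow> word_mult k g x \<in> reduced_words k"
  by (erule simple_step_letter[OF k]) (auto intro!: word_mult_closed simp: reduced_words_Cons)

text \<open>Isolates the null set on which steps leave the support, so that the geometry can be
  argued for one fixed trajectory.\<close>

definition admissible :: "letter list stream \<Rightarrow> bool" where
  "admissible \<omega> \<longleftrightarrow> (\<forall>n. \<omega> !! n \<in> set_pmf (simple_step k))"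

lemma AE_admissible: "AE \<omega> in step_space (simple_step k). admissible \<omega>"
proof -
  have "AE \<omega> in step_space (simple_step k). stream_all (\<lambda>x. x \<in> set_pmf (simple_step k)) \<omega>"
    unfolding step_space_def
    by (rule prob_space.AE_stream_all[OF prob_space_measure_pmf]) (auto simp: AE_measure_pmf_iff)
  then show ?thesis by eventually_elim (simp add: admissible_def)
qed

context
  fixes \<omega> :: "letter list stream"
  assumes adm: "admissible \<omega>"
begin

lemma walk_Suc: "walk k \<omega> (Suc n) = word_mult k (walk k \<omega> n) (\<omega> !! n)"
  by (simp add: free_product_def)

lemma walk_reduced: "walk k \<omega> n \<in> reduced_words k"
proof (induction n)
  case (Suc n)
  then show ?case
    using adm unfolding walk_Suc by (intro word_mult_closed_step) (auto simp: admissible_def)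
qed (simp add: free_product_def)

lemma walk_Suc_length:
  "length (walk k \<omega> (Suc n)) \<le> Suc (length (walk k \<omega> n))"
  "length (walk k \<omega> n) \<le> Suc (length (walk k \<omega> (Suc n)))"
  "take (length (walk k \<omega> n) - 1) (walk k \<omega> (Suc n)) = take (length (walk k \<omega> n) - 1) (walk k \<omega> n)"
proof -
  have "\<omega> !! n \<in> set_pmf (simple_step k)" using adm by (simp add: admissible_def)
  then obtain u where "\<omega> !! n = [u]" using simple_step_letter[OF k] by metis
  then show "length (walk k \<omega> (Suc n)) \<le> Suc (length (walk k \<omega> n))"
    "length (walk k \<omega> n) \<le> Suc (length (walk k \<omega> (Suc n)))"
    "take (length (walk k \<omega> n) - 1) (walk k \<omega> (Suc n)) = take (length (walk k \<omega> n) - 1) (walk k \<omega> n)"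
    using word_mult_letter_length[OF walk_reduced, of n u] unfolding walk_Suc by auto
qed

text \<open>A step touches at most the last letter, so the length has to stay strictly above
  \<open>m\<close>.\<close>

lemma walk_prefix_constant:
  assumes "N \<le> n" "\<And>n. N \<le> n \<Longrightarrow> m < length (walk k \<omega> n)"
  shows "take m (walk k \<omega> n) = take m (walk k \<omega> N)"
  using assms(1)
proof (induction n rule: dec_induct)
  case (step n)
  have m: "min m (length (walk k \<omega> n) - 1) = m" using assms(2)[OF step(1)] by simp
  have "take m (walk k \<omega> (Suc n)) = take m (take (length (walk k \<omega> n) - 1) (walk k \<omega> (Suc n)))"
    by (simp only: take_take m)
  also have "\<dots> = take m (walk k \<omega> n)"
    by (simp only: walk_Suc_length(3) take_take m)
  finally show ?case using step by simp
qed simp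

lemma limit_end_prefix:
  assumes "\<And>n. N \<le> n \<Longrightarrow> m < length (walk k \<omega> n)"
  shows "take m (walk k \<omega> N) = stake m (limit_end k \<omega>)"
proof (rule nth_equalityI)
  show "length (take m (walk k \<omega> N)) = length (stake m (limit_end k \<omega>))"
    using assms[of N] by simp
  fix j assume "j < length (take m (walk k \<omega> N))"
  then have j: "j < m" by simp
  have "letter_at k \<omega> j n = walk k \<omega> N ! j" if "N \<le> n" for n
  proof -
    have "walk k \<omega> n ! j = walk k \<omega> N ! j"
      using walk_prefix_constant[OF that assms] j by (metis nth_take)
    moreover have "walk k \<omega> n ! j \<in> letters k"
      using walk_reduced[of n] assms[OF that] j by (auto simp: reduced_words_def in_lists_conv_set)
    ultimately show ?thesis using assms[OF that] j by (simp add: letter_at_def)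
  qed
  note ev = this
  define L where "L = (LEAST N. \<forall>n\<ge>N. letter_at k \<omega> j n = letter_at k \<omega> j N)"
  have "\<forall>n\<ge>L. letter_at k \<omega> j n = letter_at k \<omega> j L"
    unfolding L_def
    by (rule LeastI[of "\<lambda>N. \<forall>n\<ge>N. letter_at k \<omega> j n = letter_at k \<omega> j N" N]) (simp add: ev)
  \<comment> \<open>The least index \<open>L\<close> and the known index \<open>N\<close> are
    compared at a common later time.\<close>
  then have "letter_at k \<omega> j (max L N) = letter_at k \<omega> j L" by (meson max.cobounded1)
  moreover have "letter_at k \<omega> j (max L N) = walk k \<omega> N ! j" by (intro ev) simp
  ultimately show "take m (walk k \<omega> N) ! j = stake m (limit_end k \<omega>) ! j"
    using j by (simp add: limit_end_def to_stream_def L_def[symmetric] del: walk.simps)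
qed

lemma limit_end_properties:
  assumes "filterlim (\<lambda>n. length (walk k \<omega> n)) at_top sequentially"
  shows "converges_to_end (walk k \<omega>) (limit_end k \<omega>)" "alternating (limit_end k \<omega>)"
proof -
  have ev: "\<forall>\<^sub>F n in sequentially. m < length (walk k \<omega> n) \<and> take m (walk k \<omega> n) = stake m (limit_end k \<omega>)" for m
  proof -
    obtain N where "\<And>n. N \<le> n \<Longrightarrow> m < length (walk k \<omega> n)"
      using assms unfolding filterlim_at_top eventually_sequentially by (metis Suc_le_eq)
    then show ?thesis
      unfolding eventually_sequentially by (intro exI[of _ N]) (auto intro!: limit_end_prefix)
  qed
  show "converges_to_end (walk k \<omega>) (limit_end k \<omega>)"
    by (intro converges_to_endI eventually_mono[OF ev]) auto
  show "alternating (limit_end k \<omega>)"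
    unfolding alternating_def
  proof
    fix j
    obtain n where n: "Suc (Suc j) < length (walk k \<omega> n)" "take (Suc (Suc j)) (walk k \<omega> n) = stake (Suc (Suc j)) (limit_end k \<omega>)"
      using ev[of "Suc (Suc j)"] by (auto simp: eventually_sequentially)
    have "successively (\<lambda>u v. fst u \<noteq> fst v) (walk k \<omega> n)"
      using walk_reduced by (simp add: reduced_words_def)
    then have "fst (walk k \<omega> n ! j) \<noteq> fst (walk k \<omega> n ! Suc j)"
      using n(1) by (simp add: successively_conv_nth)
    moreover have "walk k \<omega> n ! i = limit_end k \<omega> !! i" if "i < Suc (Suc j)" for i
      using that n(2) by (metis nth_take stake_nth)
    ultimately show "fst (limit_end k \<omega> !! j) \<noteq> fst (limit_end k \<omega> !! Suc j)" by simp
  qed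
qed

end

section \<open>Linear growth, transience and the limit word\<close>

lemma AE_potential_rate:
  "AE \<omega> in step_space (simple_step k). (\<lambda>n. potential k (walk k \<omega> n) / real n) \<longlonglongrightarrow> (real k - 2) / 2"
proof -
  define c where "c = real k / 2 / (1 - root_F k)"
  have "0 < c" using root_F[OF k] k by (simp add: c_def)
  then have c: "0 \<le> c" by simp
  \<comment> \<open>The increment bound as plain arithmetic: \<open>A\<close> and \<open>B\<close>
    stand for the potentials, \<open>q\<close> and \<open>p\<close> for the correction
    terms.\<close>
  have lin: "\<bar>A + q - (B + p) - (K - 2) / 2\<bar> \<le> Z + d + K"
    if "\<bar>A - B\<bar> \<le> Z" "0 \<le> p" "p \<le> d * 1" "0 \<le> q" "q \<le> d * 1" "3 \<le> K" for A B Z p q d K :: real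
    using that by (auto simp: abs_le_iff field_simps)
  have cp: "corrected_potential k g = potential k g + c * word_weight k g" for g
    by (simp add: corrected_potential_def[OF k] c_def)
  have "AE \<omega> in stream_space (measure_pmf (simple_step k)).
      (\<lambda>n. corrected_potential k (foldl (word_mult k) [] (stake n \<omega>)) / real n) \<longlonglongrightarrow> (real k - 2) / 2"
  proof (rule strong_law_bounded_increments[where S="reduced_words k" and K="2 * real (k * k) + c + real k"])
    fix g x assume g: "g \<in> reduced_words k" and x: "x \<in> set_pmf (simple_step k)"
    show "word_mult k g x \<in> reduced_words k" using g x by (rule word_mult_closed_step)
    obtain u where u: "u \<in> letters k" "x = [u]" using x by (rule simple_step_letter[OF k])
    have "\<bar>potential k (word_mult k g x) - potential k g\<bar> \<le> 2 * real (k * k)"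
      using potential_increment[OF k g u(1)] u(2) by simp
    moreover have "0 \<le> c * word_weight k g" "c * word_weight k g \<le> c * 1"
      "0 \<le> c * word_weight k (word_mult k g x)" "c * word_weight k (word_mult k g x) \<le> c * 1"
      using word_weight_bounds[OF k g] word_weight_bounds[OF k word_mult_closed_step[OF g x]] c
      by (auto intro!: mult_left_mono mult_nonneg_nonneg simp del: mult_1_right)
    moreover have "3 \<le> real k" using k by simp
    ultimately show "\<bar>corrected_potential k (word_mult k g x) - corrected_potential k g - (real k - 2) / 2\<bar>
        \<le> 2 * real (k * k) + c + real k"
      unfolding cp by (rule lin)
  next
    fix g assume "g \<in> reduced_words k"
    then show "measure_pmf.expectation (simple_step k) (\<lambda>x. corrected_potential k (word_mult k g x)) =
        corrected_potential k g + (real k - 2) / 2"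
      using step_mean_corrected_potential[OF k] by (simp add: step_mean_def)
  qed (use \<open>0 < c\<close> k in \<open>auto intro!: add_nonneg_pos add_pos_nonneg\<close>)
  then show ?thesis
    using AE_admissible unfolding step_space_def
  proof eventually_elim
    case (elim \<omega>)
    have "(\<lambda>n. c * word_weight k (walk k \<omega> n) / real n) \<longlonglongrightarrow> 0"
    proof (rule tendsto_sandwich[OF _ _ tendsto_const lim_const_over_n[of c]])
      have "0 \<le> c * word_weight k (walk k \<omega> n)" "c * word_weight k (walk k \<omega> n) \<le> c * 1" for n
        using word_weight_bounds[OF k walk_reduced[OF elim(2)]] c
        by (auto intro!: mult_left_mono mult_nonneg_nonneg simp del: mult_1_right simp: less_imp_le)
      then show "\<forall>\<^sub>F n in sequentially. 0 \<le> c * word_weight k (walk k \<omega> n) / real n"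
        "\<forall>\<^sub>F n in sequentially. c * word_weight k (walk k \<omega> n) / real n \<le> c / real n"
        by (auto intro!: divide_right_mono always_eventually)
    qed
    from tendsto_diff[OF elim(1) this] show ?case
      by (simp add: cp walk_foldl diff_divide_distrib[symmetric])
  qed
qed

lemma AE_length_at_top:
  "AE \<omega> in step_space (simple_step k). filterlim (\<lambda>n. length (walk k \<omega> n)) at_top sequentially"
  using AE_potential_rate AE_admissible
proof eventually_elim
  case (elim \<omega>)
  have "filterlim (\<lambda>n. potential k (walk k \<omega> n) / real n * real n) at_top sequentially"
    using k by (intro filterlim_tendsto_pos_mult_at_top[OF elim(1)] filterlim_real_sequentially) auto
  moreover have "\<forall>\<^sub>F n in sequentially. potential k (walk k \<omega> n) / real n * real n \<le> real (k * k) * real (length (walk k \<omega> n))"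
    using eventually_gt_at_top[of 0]
    by eventually_elim (use potential_bounds(2)[OF k walk_reduced[OF elim(2)]] in \<open>simp del: of_nat_mult\<close>)
  ultimately have "filterlim (\<lambda>n. real (k * k) * real (length (walk k \<omega> n))) at_top sequentially"
    by (rule filterlim_at_top_mono)
  then have "filterlim (\<lambda>n. real (length (walk k \<omega> n))) at_top sequentially"
    using k by (subst (asm) filterlim_tendsto_pos_mult_at_top_iff[OF tendsto_const]) auto
  then show ?case
    by (simp add: filterlim_sequentially_iff_filterlim_real)
qed

lemma AE_converges:
  "AE \<omega> in step_space (simple_step k).
    alternating (limit_end k \<omega>) \<and> converges_to_end (walk k \<omega>) (limit_end k \<omega>)"
  using AE_length_at_top AE_admissible
  by eventually_elim (simp add: limit_end_properties)

text \<open>A trajectory has at most one limit, so all choices of \<open>X_inf\<close> agree almost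
  surely and the \<open>THE\<close> in \<open>harmonic_measure\<close> is well defined.\<close>

lemma is_harmonic_measure_iff:
  "is_harmonic_measure k (simple_step k) \<nu> \<longleftrightarrow> \<nu> = distr (step_space (simple_step k)) (word_space k) (limit_end k)"
proof
  assume "is_harmonic_measure k (simple_step k) \<nu>"
  then obtain X where X: "X \<in> measurable (step_space (simple_step k)) (word_space k)"
    and AE: "AE \<omega> in step_space (simple_step k). alternating (X \<omega>) \<and> converges_to_end (walk k \<omega>) (X \<omega>)"
    and \<nu>: "\<nu> = distr (step_space (simple_step k)) (word_space k) X"
    unfolding is_harmonic_measure_def by blast
  have "AE \<omega> in step_space (simple_step k). X \<omega> = limit_end k \<omega>"
    using AE AE_converges by eventually_elim (auto intro: converges_to_end_unique)
  then show "\<nu> = distr (step_space (simple_step k)) (word_space k) (limit_end k)"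
    unfolding \<nu> using X limit_end_measurable k by (intro distr_cong_AE) auto
next
  assume "\<nu> = distr (step_space (simple_step k)) (word_space k) (limit_end k)"
  then show "is_harmonic_measure k (simple_step k) \<nu>"
    unfolding is_harmonic_measure_def using limit_end_measurable[of k] AE_converges k by auto
qed

lemma harmonic_measure_eq:
  "harmonic_measure k (simple_step k) = distr (step_space (simple_step k)) (word_space k) (limit_end k)"
  unfolding harmonic_measure_def is_harmonic_measure_iff by simp

section \<open>Boundary values of \<open>hit\<close> and the mass of cylinders\<close>

lemma word_weight_decay: "\<exists>\<rho>. 0 < \<rho> \<and> \<rho> < 1 \<and> (\<forall>w \<in> reduced_words k. word_weight k w \<le> \<rho> ^ length w)"
proof -
  define \<rho> where "\<rho> = Max (weight k ` {1..<k})"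
  have ne: "finite (weight k ` {1..<k})" "weight k ` {1..<k} \<noteq> {}" using k by auto
  then have "\<rho> \<in> weight k ` {1..<k}" unfolding \<rho>_def by (rule Max_in)
  then have \<rho>: "0 < \<rho>" "\<rho> < 1" using weight_pos[OF k] weight_less_1[OF k] by auto
  have "word_weight k w \<le> \<rho> ^ length w" if "w \<in> reduced_words k" for w
    using that
  proof (induction w)
    case (Cons u w)
    then have u: "snd u \<in> {1..<k}" "w \<in> reduced_words k" by (auto simp: reduced_words_Cons letters_iff)
    have "weight k (snd u) \<le> \<rho>" unfolding \<rho>_def using ne u by (intro Max_ge) auto
    then show ?case
      using Cons.IH[OF u(2)] weight_pos[OF k, of "snd u"] word_weight_bounds[OF k u(2)] \<rho>
      by (auto intro!: mult_mono)
  qed simp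
  with \<rho> show ?thesis by blast
qed

lemma hit_bounds:
  assumes "g \<in> reduced_words k" "u \<in> reduced_words k"
  shows "0 \<le> hit k u g \<and> hit k u g \<le> 1"
  using assms
proof (induction g arbitrary: u)
  case Nil
  then show ?case
    using word_weight_bounds[OF k, of u] by (cases u) (auto simp del: word_weight_simps)
next
  case (Cons v vs)
  show ?case
  proof (cases u)
    case (Cons x us)
    have red: "vs \<in> reduced_words k" "us \<in> reduced_words k"
      using Cons.prems by (auto simp: Cons reduced_words_Cons)
    note b = word_weight_bounds[OF k red(1)] word_weight_bounds[OF k red(2)]
      word_weight_bounds[OF k Cons.prems(1)] word_weight_bounds[OF k Cons.prems(2)]
    have d: "0 < snd v" "snd v < k" "0 < snd x" "snd x < k"
      using Cons.prems by (auto simp: Cons reduced_words_Cons letters_iff)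
    consider "fst x \<noteq> fst v" | "x = v" | "fst x = fst v" "snd x \<noteq> snd v"
      by (metis prod_eqI)
    then show ?thesis
    proof cases
      case 1
      have "word_weight k (v # vs) * word_weight k u \<le> 1" "0 \<le> word_weight k (v # vs) * word_weight k u"
        using b by (auto intro!: mult_le_one simp: Cons simp del: word_weight_simps)
      then show ?thesis using 1 by (simp add: Cons del: word_weight_simps)
    next
      case 2
      then show ?thesis using b(1) Cons.IH[OF red] by (simp add: Cons)
    next
      case 3
      define l where "l = (if snd x < snd v then snd v - snd x else snd x - snd v)"
      have l: "0 < l" "l < k" using d 3 by (auto simp: l_def)
      have "word_weight k vs * weight k l * word_weight k us \<le> 1"
        "0 \<le> word_weight k vs * weight k l * word_weight k us"
        using b(1,2) weight_less_1[OF k l] weight_pos[OF k, of l]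
        by (auto intro!: mult_le_one simp: less_imp_le)
      moreover have "hit k u (v # vs) = word_weight k vs * weight k l * word_weight k us / 2"
        using 3 by (auto simp: Cons l_def)
      ultimately show ?thesis by simp
    qed
  qed simp
qed

lemma hit_prefix: "u \<noteq> [] \<Longrightarrow> hit k u (u @ t) = 1 - word_weight k t / 2"
proof (induction u)
  case (Cons x u)
  then show ?case by (cases "u = []") auto
qed simp

text \<open>The first mismatch lies among the first \<open>length u\<close> letters, so at least
  \<open>length g - length u\<close> letters behind it have to be erased.\<close>

lemma hit_nonprefix:
  assumes \<rho>: "0 < \<rho>" "\<rho> < 1" "\<And>w. w \<in> reduced_words k \<Longrightarrow> word_weight k w \<le> \<rho> ^ length w"
    and "g \<in> reduced_words k" "u \<in> reduced_words k" "length u \<le> length g" "take (length u) g \<noteq> u"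
  shows "hit k u g \<le> \<rho> ^ (length g - length u)"
  using assms(4-)
proof (induction g arbitrary: u)
  case (Cons v vs)
  then obtain x us where u: "u = x # us" by (cases u) auto
  have red: "vs \<in> reduced_words k" "us \<in> reduced_words k"
    using Cons.prems by (auto simp: u reduced_words_Cons)
  note b = word_weight_bounds[OF k red(1)] word_weight_bounds[OF k red(2)]
    word_weight_bounds[OF k Cons.prems(1)] word_weight_bounds[OF k Cons.prems(2)]
  have d: "0 < snd v" "snd v < k" "0 < snd x" "snd x < k"
    using Cons.prems by (auto simp: u reduced_words_Cons letters_iff)
  have len: "length (v # vs) - length u \<le> length vs" "length (v # vs) - length u \<le> length (v # vs)"
    by (auto simp: u)
  have dec: "\<rho> ^ length vs \<le> \<rho> ^ (length (v # vs) - length u)"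
    "\<rho> ^ length (v # vs) \<le> \<rho> ^ (length (v # vs) - length u)"
    using \<rho>(1,2) len by (auto intro!: power_decreasing simp del: power_Suc list.size)
  consider "fst x \<noteq> fst v" | "x = v" | "fst x = fst v" "snd x \<noteq> snd v"
    by (metis prod_eqI)
  then show ?case
  proof cases
    case 1
    have "word_weight k (v # vs) * word_weight k u \<le> \<rho> ^ length (v # vs) * 1"
      using b \<rho>(1) \<rho>(3)[OF Cons.prems(1)] by (intro mult_mono) (auto simp del: word_weight_simps)
    moreover have "0 \<le> word_weight k (v # vs) * word_weight k u"
      using b by (simp del: word_weight_simps)
    ultimately have "word_weight k (v # vs) * word_weight k u / 2 \<le> \<rho> ^ length (v # vs)"
      by linarith
    then show ?thesis using dec(2) 1 by (simp add: u del: word_weight_simps power_Suc list.size)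
  next
    case 2
    then have "us \<noteq> []" using Cons.prems(4) by (auto simp: u)
    then show ?thesis using Cons.IH[OF red] Cons.prems(3,4) 2 by (simp add: u)
  next
    case 3
    define l where "l = (if snd x < snd v then snd v - snd x else snd x - snd v)"
    have l: "0 < l" "l < k" using d 3 by (auto simp: l_def)
    have "word_weight k vs * (weight k l * word_weight k us) \<le> \<rho> ^ length vs * 1"
      using b(1,2) \<rho>(1) \<rho>(3)[OF red(1)] weight_less_1[OF k l] weight_pos[OF k, of l]
      by (intro mult_mono mult_le_one) (auto simp: less_imp_le)
    moreover have "0 \<le> word_weight k vs * (weight k l * word_weight k us)"
      using b(1,2) weight_pos[OF k, of l] by simp
    moreover have "hit k u (v # vs) = word_weight k vs * (weight k l * word_weight k us) / 2"
      using 3 by (auto simp: u l_def)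
    ultimately show ?thesis using dec(1) by linarith
  qed
qed simp

lemma limit_end_in_streams: "limit_end k \<omega> \<in> streams (letters k)"
  unfolding limit_end_def to_stream_in_streams
  using k by (auto simp: letter_at_def letters_iff)

lemma hit_tendsto:
  assumes adm: "admissible \<omega>" and lim: "filterlim (\<lambda>n. length (walk k \<omega> n)) at_top sequentially"
    and u: "u \<in> reduced_words k" "u \<noteq> []"
  shows "(\<lambda>n. hit k u (walk k \<omega> n)) \<longlonglongrightarrow> (if stake (length u) (limit_end k \<omega>) = u then 1 else 0)"
proof -
  obtain \<rho> where \<rho>: "0 < \<rho>" "\<rho> < 1" "\<And>w. w \<in> reduced_words k \<Longrightarrow> word_weight k w \<le> \<rho> ^ length w"
    using word_weight_decay by blast
  have ev: "\<forall>\<^sub>F n in sequentially. length u \<le> length (walk k \<omega> n) \<and>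
      take (length u) (walk k \<omega> n) = stake (length u) (limit_end k \<omega>)"
    by (rule converges_to_endD[OF limit_end_properties(1)[OF adm lim]])
  have len: "filterlim (\<lambda>n. length (walk k \<omega> n) - length u) at_top sequentially"
    by (rule filterlim_compose[OF filterlim_minus_const_nat_at_top lim])
  have z: "(\<lambda>n. \<rho> ^ (length (walk k \<omega> n) - length u)) \<longlonglongrightarrow> 0"
    by (rule filterlim_compose[OF LIMSEQ_power_zero len]) (use \<rho> in auto)
  show ?thesis
  proof (cases "stake (length u) (limit_end k \<omega>) = u")
    case True
    have "\<forall>\<^sub>F n in sequentially. norm (hit k u (walk k \<omega> n) - 1) \<le> \<rho> ^ (length (walk k \<omega> n) - length u)"
      using ev
    proof eventually_elim
      case (elim n)
      define t where "t = drop (length u) (walk k \<omega> n)"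
      have w: "walk k \<omega> n = u @ t"
        using elim True by (metis append_take_drop_id t_def)
      have "t \<in> reduced_words k"
        using walk_reduced[OF adm, of n] unfolding w by (auto simp: reduced_words_def successively_append_iff)
      then show ?case
        using \<rho>(3)[of t] word_weight_bounds[OF k, of t] u(2) unfolding w by (simp add: hit_prefix)
    qed
    from Lim_null_comparison[OF this z] have "(\<lambda>n. hit k u (walk k \<omega> n)) \<longlonglongrightarrow> 1"
      by (rule LIM_zero_cancel)
    then show ?thesis using True by simp
  next
    case False
    have "\<forall>\<^sub>F n in sequentially. norm (hit k u (walk k \<omega> n)) \<le> \<rho> ^ (length (walk k \<omega> n) - length u)"
      using ev
    proof eventually_elim
      case (elim n)
      then show ?case
        using hit_nonprefix[OF \<rho> walk_reduced[OF adm] u(1)] False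
          hit_bounds[OF walk_reduced[OF adm] u(1)] by simp
    qed
    from Lim_null_comparison[OF this z] show ?thesis using False by simp
  qed
qed

lemma sstart_in_word_space:
  assumes "u \<in> lists (letters k)"
  shows "sstart (letters k) u \<in> sets (word_space k)"
proof -
  have "sstart (letters k) ` lists (letters k) \<union> {{}} \<subseteq> Pow (streams (letters k))"
    by (simp add: image_subset_iff sstart_in_streams)
  moreover have "sstart (letters k) u \<in> sstart (letters k) ` lists (letters k) \<union> {{}}"
    using assms by (intro UnI1 imageI)
  ultimately show ?thesis
    unfolding word_space_def sets_stream_space_sstart[OF countableI_type] by (rule in_measure_of)
qed

lemma emeasure_harmonic_cylinder:
  assumes u: "u \<in> reduced_words k" "u \<noteq> []"
  shows "emeasure (harmonic_measure k (simple_step k)) (sstart (letters k) u) = ennreal (word_weight k u / 2)"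
proof -
  let ?M = "step_space (simple_step k)"
  interpret prob_space ?M unfolding step_space_def by (rule prob_space_stream_pmf)
  have ul: "u \<in> lists (letters k)" using u by (simp add: reduced_words_def)
  have [measurable]: "limit_end k \<in> measurable ?M (word_space k)"
    using k by (intro limit_end_measurable) simp
  note [measurable] = sstart_in_word_space[OF ul]
  let ?I = "limit_end k -` sstart (letters k) u \<inter> space ?M"
  have I: "?I \<in> sets ?M" by measurable
  have hit_meas: "(\<lambda>\<omega>. ennreal (hit k u (walk k \<omega> n))) \<in> borel_measurable ?M" for n
    unfolding walk_foldl step_space_def by measurable
  have "(\<lambda>n. \<integral>\<^sup>+\<omega>. ennreal (hit k u (walk k \<omega> n)) \<partial>?M) \<longlonglongrightarrow> (\<integral>\<^sup>+\<omega>. indicator ?I \<omega> \<partial>?M)"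
  proof (rule nn_integral_dominated_convergence[where w="\<lambda>_. 1"])
    show "AE \<omega> in ?M. ennreal (hit k u (walk k \<omega> n)) \<le> 1" for n
      using AE_admissible
      by eventually_elim (use hit_bounds[OF walk_reduced u(1)] in simp)
    show "AE \<omega> in ?M. (\<lambda>n. ennreal (hit k u (walk k \<omega> n))) \<longlonglongrightarrow> indicator ?I \<omega>"
      using AE_admissible AE_length_at_top AE_space
    proof eventually_elim
      case (elim \<omega>)
      have "(\<lambda>n. ennreal (hit k u (walk k \<omega> n))) \<longlonglongrightarrow> ennreal (if stake (length u) (limit_end k \<omega>) = u then 1 else 0)"
        by (intro tendsto_ennrealI hit_tendsto elim u)
      then show ?case
        using elim(3) by (simp add: sstart_iff_stake[OF limit_end_in_streams] indicator_def split: if_splits)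
    qed
    show "(\<lambda>\<omega>. ennreal (hit k u (walk k \<omega> n))) \<in> borel_measurable ?M" for n by (rule hit_meas)
    show "indicator ?I \<in> borel_measurable ?M" using I by (rule borel_measurable_indicator)
    show "(\<integral>\<^sup>+\<omega>. 1 \<partial>?M) < \<infinity>" by (simp add: emeasure_space_1)
  qed simp
  moreover have "(\<integral>\<^sup>+\<omega>. ennreal (hit k u (walk k \<omega> n)) \<partial>?M) = ennreal (word_weight k u / 2)" for n
  proof -
    have "(\<integral>\<^sup>+\<omega>. ennreal (hit k u (walk k \<omega> n)) \<partial>?M) = ennreal (hit k u [])"
      unfolding walk_foldl step_space_def
      by (rule nn_integral_harmonic[where S="reduced_words k"])
         (use hit_bounds hit_harmonic[OF k] u word_mult_closed_step in \<open>auto simp: step_mean_def\<close>)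
    also have "hit k u [] = word_weight k u / 2" using u(2) by (cases u) auto
    finally show ?thesis .
  qed
  ultimately have "(\<integral>\<^sup>+\<omega>. indicator ?I \<omega> \<partial>?M) = ennreal (word_weight k u / 2)"
    by (simp add: LIMSEQ_const_iff)
  then show ?thesis
    unfolding harmonic_measure_eq by (subst emeasure_distr) auto
qed

end

section \<open>Stationarity, ergodicity and averages along the limit word\<close>

definition exponent_pmf :: "nat \<Rightarrow> nat pmf" where
  "exponent_pmf k = embed_pmf (\<lambda>i. if i \<in> {1..<k} then weight k i else 0)"

text \<open>The default value \<open>1\<close> outside \<open>{1..<k}\<close> makes every sequence of exponents a word over the letters.\<close>
definition clamp_exponent :: "nat \<Rightarrow> nat \<Rightarrow> nat" where
  "clamp_exponent k i = (if i \<in> {1..<k} then i else 1)"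

definition alternate :: "nat \<Rightarrow> factor \<Rightarrow> nat stream \<Rightarrow> letter stream" where
  "alternate k f s = to_stream (\<lambda>j. ((other ^^ j) f, clamp_exponent k (s !! j)))"

lemma alternate_Stream: "alternate k f (i ## s) = (f, clamp_exponent k i) ## alternate k (other f) s"
proof -
  have "(\<lambda>j. ((other ^^ j) f, clamp_exponent k ((i ## s) !! j))) =
      case_nat (f, clamp_exponent k i) (\<lambda>j. ((other ^^ j) (other f), clamp_exponent k (s !! j)))"
    by (auto simp: fun_eq_iff funpow_swap1 split: nat.split)
  then show ?thesis unfolding alternate_def by (simp only: to_stream_nat_case)
qed

lemma alternate_snth: "alternate k f s !! j = ((other ^^ j) f, clamp_exponent k (s !! j))"
  by (simp add: alternate_def to_stream_def)

abbreviation exponent_space :: "nat \<Rightarrow> nat stream measure" where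
  "exponent_space k \<equiv> stream_space (measure_pmf (exponent_pmf k))"

definition alternate_measure :: "nat \<Rightarrow> letter stream measure" where
  "alternate_measure k = distr (measure_pmf (pmf_of_set {FacA, FacB}) \<Otimes>\<^sub>M exponent_space k) (word_space k)
     (\<lambda>(f, s). alternate k f s)"

text \<open>The law given the first factor. The shift exchanges the two conditional laws, so they
  are kept apart before averaging.\<close>

definition alternate_prob :: "nat \<Rightarrow> factor \<Rightarrow> letter stream set \<Rightarrow> ennreal" where
  "alternate_prob k f B = emeasure (exponent_space k) {s. alternate k f s \<in> B}"

lemma space_exponent_space [simp]: "space (exponent_space k) = UNIV"
  by (simp add: space_stream_space)

lemma potential_append: "potential k (u @ v) = potential k u + potential k v"
  by (simp add: potential_def)

lemma potential_stake: "potential k (stake n \<xi>) = (\<Sum>j<n. real (snd (\<xi> !! j) * (k - snd (\<xi> !! j))))"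
  by (induction n) (auto simp: stake_Suc potential_append simp del: stake.simps(2))

context
  fixes k :: nat
  assumes k: "3 \<le> k"
begin

lemma pmf_exponent: "pmf (exponent_pmf k) i = (if i \<in> {1..<k} then weight k i else 0)"
  unfolding exponent_pmf_def
proof (rule pmf_embed_pmf)
  have "(\<integral>\<^sup>+i. ennreal (if i \<in> {1..<k} then weight k i else 0) \<partial>count_space UNIV) =
      (\<Sum>i\<in>{1..<k}. ennreal (if i \<in> {1..<k} then weight k i else 0))"
    by (rule nn_integral_count_space') auto
  also have "\<dots> = (\<Sum>i\<in>{1..<k}. ennreal (weight k i))" by (rule sum.cong) auto
  also have "\<dots> = ennreal (\<Sum>i\<in>{1..<k}. weight k i)"
    using weight_pos[OF k] by (intro sum_ennreal) (simp add: less_imp_le)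
  also have "\<dots> = 1" using sum_weight[OF k] by simp
  finally show "(\<integral>\<^sup>+i. ennreal (if i \<in> {1..<k} then weight k i else 0) \<partial>count_space UNIV) = 1" .
qed (use weight_pos[OF k] in \<open>simp add: less_imp_le\<close>)

lemma set_exponent_pmf: "set_pmf (exponent_pmf k) = {1..<k}"
  using weight_pos[OF k] by (auto simp: set_pmf_eq pmf_exponent less_imp_neq[symmetric] split: if_splits)

lemma alternate_measurable: "alternate k f \<in> measurable (exponent_space k) (word_space k)"
  unfolding word_space_def
proof (rule measurable_stream_space2)
  fix j
  have "(\<lambda>i. ((other ^^ j) f, clamp_exponent k i)) \<in> measurable (measure_pmf (exponent_pmf k)) (count_space (letters k))"
    using k by (auto simp: clamp_exponent_def letters_iff)
  from measurable_compose[OF measurable_snth this]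
  show "(\<lambda>s. alternate k f s !! j) \<in> measurable (exponent_space k) (count_space (letters k))"
    by (simp add: alternate_snth)
qed

lemma alternate_vimage:
  assumes "B \<in> sets (word_space k)"
  shows "{s. alternate k f s \<in> B} \<in> sets (exponent_space k)"
  using measurable_sets[OF alternate_measurable assms] by (simp add: vimage_def)

lemma alternate_streams: "alternate k f s \<in> streams (letters k)"
  using k unfolding alternate_def to_stream_in_streams by (auto simp: clamp_exponent_def letters_iff)

lemma alternate_prob_Stream:
  assumes "{s. R s} \<in> sets (exponent_space k)"
  shows "emeasure (exponent_space k) {s. R s} = (\<integral>\<^sup>+i. emeasure (exponent_space k) {s. R (i ## s)} \<partial>measure_pmf (exponent_pmf k))"
  using prob_space.emeasure_stream_space[OF prob_space_measure_pmf assms] by simp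

lemma alternate_prob_shift:
  assumes "B \<in> sets (word_space k)"
  shows "emeasure (exponent_space k) {s. alternate k f (stl s) \<in> B} = alternate_prob k f B"
proof -
  have "stl -` {s. alternate k f s \<in> B} \<inter> space (exponent_space k) \<in> sets (exponent_space k)"
    by (rule measurable_sets[OF measurable_stl alternate_vimage[OF assms]])
  then have "{s. alternate k f (stl s) \<in> B} \<in> sets (exponent_space k)" by (simp add: vimage_def)
  from alternate_prob_Stream[OF this] show ?thesis by (simp add: alternate_prob_def)
qed

lemma pair_alternate_measurable:
  "(\<lambda>(f, s). alternate k f s) \<in>
    measurable (measure_pmf (pmf_of_set {FacA, FacB}) \<Otimes>\<^sub>M exponent_space k) (word_space k)"
proof -
  have "(\<lambda>(f, s). alternate k f s) \<in> measurable (count_space UNIV \<Otimes>\<^sub>M exponent_space k) (word_space k)"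
    by (rule measurable_pair_measure_countable1) (use alternate_measurable in auto)
  then show ?thesis by (simp cong: measurable_cong_sets add: sets_pair_measure_cong)
qed

lemma emeasure_alternate_measure:
  assumes B: "B \<in> sets (word_space k)"
  shows "emeasure (alternate_measure k) B = (alternate_prob k FacA B + alternate_prob k FacB B) / 2"
proof -
  interpret P: prob_space "exponent_space k" by (rule prob_space_stream_pmf)
  let ?X = "(\<lambda>(f, s). alternate k f s) -` B \<inter> space (measure_pmf (pmf_of_set {FacA, FacB}) \<Otimes>\<^sub>M exponent_space k)"
  have "emeasure (alternate_measure k) B = emeasure (measure_pmf (pmf_of_set {FacA, FacB}) \<Otimes>\<^sub>M exponent_space k) ?X"
    unfolding alternate_measure_def by (rule emeasure_distr[OF pair_alternate_measurable B])
  also have "\<dots> = (\<integral>\<^sup>+f. emeasure (exponent_space k) (Pair f -` ?X) \<partial>measure_pmf (pmf_of_set {FacA, FacB}))"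
    by (rule P.emeasure_pair_measure_alt[OF measurable_sets[OF pair_alternate_measurable B]])
  also have "\<dots> = (\<integral>\<^sup>+f. alternate_prob k f B \<partial>measure_pmf (pmf_of_set {FacA, FacB}))"
    by (simp add: alternate_prob_def vimage_def space_pair_measure)
  also have "\<dots> = (alternate_prob k FacA B + alternate_prob k FacB B) / 2"
    by (subst nn_integral_pmf_of_set) auto
  finally show ?thesis .
qed

lemma prob_space_alternate_measure: "prob_space (alternate_measure k)"
proof -
  interpret P: prob_space "exponent_space k" by (rule prob_space_stream_pmf)
  interpret PP: pair_prob_space "measure_pmf (pmf_of_set {FacA, FacB})" "exponent_space k" ..
  show ?thesis unfolding alternate_measure_def by (rule PP.P.prob_space_distr[OF pair_alternate_measurable])
qed

lemma sets_alternate_measure: "sets (alternate_measure k) = sets (word_space k)"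
  by (simp add: alternate_measure_def)

lemma space_word_space: "space (word_space k) = streams (letters k)"
  by (simp add: word_space_def space_stream_space)

text \<open>With \<open>q = 1\<close> and \<open>E\<close> the full space this is the cylinder formula; for a shift invariant \<open>E\<close>
  it expresses the independence of \<open>E\<close> and the cylinders.\<close>
lemma alternate_prob_cylinder:
  assumes E: "E \<in> sets (word_space k)" "\<And>\<xi>. \<xi> \<in> streams (letters k) \<Longrightarrow> stl \<xi> \<in> E \<longleftrightarrow> \<xi> \<in> E"
    and q: "\<And>f. alternate_prob k f E = q"
    and u: "u \<in> lists (letters k)"
  shows "alternate_prob k f (E \<inter> sstart (letters k) u) =
    (if u \<in> reduced_words k \<and> (u = [] \<or> fst (hd u) = f) then q * ennreal (word_weight k u) else 0)"
  using u
proof (induction u arbitrary: f rule: list.induct)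
  case Nil
  have "alternate_prob k f (E \<inter> sstart (letters k) []) = alternate_prob k f E"
    by (simp add: alternate_prob_def alternate_streams)
  then show ?case using q by simp
next
  case (Cons x u)
  let ?S = "sstart (letters k)"
  have m: "E \<inter> ?S (x # u) \<in> sets (word_space k)"
    using E(1) sstart_in_word_space[OF k Cons.prems] by (rule sets.Int)
  have "alternate_prob k f (E \<inter> ?S (x # u)) =
      (\<integral>\<^sup>+i. emeasure (exponent_space k) {s. alternate k f (i ## s) \<in> E \<inter> ?S (x # u)} \<partial>measure_pmf (exponent_pmf k))"
    unfolding alternate_prob_def by (rule alternate_prob_Stream[OF alternate_vimage[OF m]])
  also have "\<dots> = (\<integral>\<^sup>+i. (if fst x = f then 1 else 0) * alternate_prob k (other f) (E \<inter> ?S u) * indicator {snd x} i \<partial>measure_pmf (exponent_pmf k))"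
  proof (rule nn_integral_cong_AE)
    have "emeasure (exponent_space k) {s. alternate k f (i ## s) \<in> E \<inter> ?S (x # u)} =
        (if fst x = f then 1 else 0) * alternate_prob k (other f) (E \<inter> ?S u) * indicator {snd x} i"
      if i: "i \<in> {1..<k}" for i
    proof -
      have "alternate k f (i ## s) \<in> E \<longleftrightarrow> alternate k (other f) s \<in> E" for s
        using E(2)[OF alternate_streams, of f "i ## s"] by (simp add: alternate_Stream)
      moreover have "alternate k f (i ## s) \<in> ?S (x # u) \<longleftrightarrow> x = (f, i) \<and> alternate k (other f) s \<in> ?S u" for s
        using i by (auto simp: alternate_Stream clamp_exponent_def)
      ultimately show ?thesis
        by (cases x) (auto simp: alternate_prob_def indicator_def)
    qed
    then show "AE i in measure_pmf (exponent_pmf k).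
        emeasure (exponent_space k) {s. alternate k f (i ## s) \<in> E \<inter> ?S (x # u)} =
        (if fst x = f then 1 else 0) * alternate_prob k (other f) (E \<inter> ?S u) * indicator {snd x} i"
      by (simp add: AE_measure_pmf_iff set_exponent_pmf)
  qed
  also have "\<dots> = (if fst x = f then 1 else 0) * alternate_prob k (other f) (E \<inter> ?S u) * ennreal (weight k (snd x))"
    using Cons.prems by (simp add: nn_integral_cmult emeasure_pmf_single pmf_exponent letters_iff)
  also have "\<dots> = (if x # u \<in> reduced_words k \<and> fst x = f then q * ennreal (word_weight k (x # u)) else 0)"
  proof -
    have "u \<in> lists (letters k)" "x \<in> letters k" using Cons.prems by auto
    moreover have "fst (hd u) = other f \<longleftrightarrow> f \<noteq> fst (hd u)" by (simp add: factor_neq_iff)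
    moreover have "u \<in> reduced_words k \<Longrightarrow> 0 \<le> word_weight k u"
      using word_weight_bounds[OF k, of u] by simp
    ultimately show ?thesis
      using Cons.IH[of "other f"] weight_pos[OF k, of "snd x"]
      by (auto simp: reduced_words_Cons ennreal_mult mult_ac)
  qed
  finally show ?case by simp
qed

lemma emeasure_alternate_cylinder:
  assumes u: "u \<in> lists (letters k)" "u \<noteq> []"
  shows "emeasure (alternate_measure k) (sstart (letters k) u) =
    (if u \<in> reduced_words k then ennreal (word_weight k u / 2) else 0)"
proof -
  interpret P: prob_space "exponent_space k" by (rule prob_space_stream_pmf)
  let ?E = "streams (letters k)"
  have "?E \<inter> sstart (letters k) u = sstart (letters k) u"
    using sstart_in_streams[OF u(1)] by blast
  moreover have "alternate_prob k f (?E \<inter> sstart (letters k) u) =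
    (if u \<in> reduced_words k \<and> (u = [] \<or> fst (hd u) = f) then 1 * ennreal (word_weight k u) else 0)" for f
  proof (rule alternate_prob_cylinder)
    show "?E \<in> sets (word_space k)" using sets.top[of "word_space k"] by (simp add: space_word_space)
    show "stl \<xi> \<in> ?E \<longleftrightarrow> \<xi> \<in> ?E" if "\<xi> \<in> ?E" for \<xi> using that by (simp add: streams_stl)
    show "alternate_prob k f ?E = 1" for f
      using P.emeasure_space_1 by (simp add: alternate_prob_def alternate_streams)
  qed (rule u(1))
  ultimately have "alternate_prob k f (sstart (letters k) u) =
    (if u \<in> reduced_words k \<and> fst (hd u) = f then ennreal (word_weight k u) else 0)" for f
    using u(2) by simp
  moreover have "fst (hd u) = FacA \<or> fst (hd u) = FacB" by (cases "fst (hd u)") auto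
  ultimately show ?thesis
    using word_weight_bounds[OF k, of u]
    by (auto simp: emeasure_alternate_measure[OF sstart_in_word_space[OF k u(1)]] ennreal_divide_numeral[symmetric])
qed

text \<open>Cylinders of reduced words have been computed on both sides. All others are null, on the
  left because the limit word alternates almost surely.\<close>

lemma harmonic_measure_alternate: "harmonic_measure k (simple_step k) = alternate_measure k"
proof (rule stream_measure_eqI_sstart[of "letters k"])
  let ?M = "step_space (simple_step k)"
  interpret M: prob_space ?M unfolding step_space_def by (rule prob_space_stream_pmf)
  have lm: "limit_end k \<in> measurable ?M (word_space k)" using k by (intro limit_end_measurable) simp
  show "prob_space (harmonic_measure k (simple_step k))"
    unfolding harmonic_measure_eq[OF k] by (rule M.prob_space_distr[OF lm])
  show "sets (harmonic_measure k (simple_step k)) = sets (stream_space (count_space (letters k)))"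
    unfolding harmonic_measure_eq[OF k] by (simp add: word_space_def)
  show "sets (alternate_measure k) = sets (stream_space (count_space (letters k)))"
    by (simp add: sets_alternate_measure word_space_def)
  show "emeasure (harmonic_measure k (simple_step k)) (sstart (letters k) u) = emeasure (alternate_measure k) (sstart (letters k) u)"
    if u: "u \<in> lists (letters k)" "u \<noteq> []" for u
  proof (cases "u \<in> reduced_words k")
    case True
    then show ?thesis
      using emeasure_harmonic_cylinder[OF k True u(2)] emeasure_alternate_cylinder[OF u] by simp
  next
    case False
    have "AE \<omega> in ?M. \<not> limit_end k \<omega> \<in> sstart (letters k) u"
      using AE_converges[OF k]
    proof eventually_elim
      case (elim \<omega>)
      show ?case
      proof
        assume "limit_end k \<omega> \<in> sstart (letters k) u"
        then have e: "stake (length u) (limit_end k \<omega>) = u"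
          by (simp only: sstart_iff_stake[OF limit_end_in_streams[OF k]])
        have "successively (\<lambda>u v. fst u \<noteq> fst v) (stake (length u) (limit_end k \<omega>))"
          using elim by (simp add: successively_conv_nth alternating_def del: snth.simps)
        then show False using False u e by (simp add: reduced_words_def)
      qed
    qed
    then have "emeasure ?M {\<omega> \<in> space ?M. limit_end k \<omega> \<in> sstart (letters k) u} = 0"
      by (rule emeasure_eq_0_AE)
    moreover have "emeasure (harmonic_measure k (simple_step k)) (sstart (letters k) u) =
        emeasure ?M (limit_end k -` sstart (letters k) u \<inter> space ?M)"
      unfolding harmonic_measure_eq[OF k] by (rule emeasure_distr[OF lm sstart_in_word_space[OF k u(1)]])
    moreover have "limit_end k -` sstart (letters k) u \<inter> space ?M = {\<omega> \<in> space ?M. limit_end k \<omega> \<in> sstart (letters k) u}"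
      by blast
    ultimately show ?thesis using emeasure_alternate_cylinder[OF u] False by simp
  qed
qed (simp_all add: prob_space_alternate_measure)

lemma stl_measurable: "stl \<in> measurable (alternate_measure k) (alternate_measure k)"
proof -
  have "stl \<in> measurable (word_space k) (word_space k)"
    unfolding word_space_def by (rule measurable_stl)
  then show ?thesis by (simp cong: measurable_cong_sets add: sets_alternate_measure)
qed

lemma stl_vimage:
  assumes "B \<in> sets (word_space k)"
  shows "stl -` B \<inter> streams (letters k) \<in> sets (word_space k)"
  using measurable_sets[OF stl_measurable, of B] assms sets_eq_imp_space_eq[OF sets_alternate_measure]
  by (simp add: sets_alternate_measure space_word_space)

lemma alternate_prob_stl:
  assumes "B \<in> sets (word_space k)"
  shows "alternate_prob k f (stl -` B \<inter> streams (letters k)) = alternate_prob k (other f) B"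
proof -
  have "stl (alternate k f s) = alternate k (other f) (stl s)" for s
    using alternate_Stream[of k f "shd s" "stl s"] by simp
  then show ?thesis
    using alternate_prob_shift[OF assms, of "other f"]
    by (simp add: alternate_prob_def alternate_streams)
qed

text \<open>The shift exchanges the laws belonging to the two first factors, and the fair coin makes
  their average invariant.\<close>

lemma alternate_measure_stationary: "shift_stationary (alternate_measure k)"
  unfolding shift_stationary_def
proof
  show "distr (alternate_measure k) (alternate_measure k) stl = alternate_measure k"
  proof (rule measure_eqI)
    fix B assume "B \<in> sets (distr (alternate_measure k) (alternate_measure k) stl)"
    then have B: "B \<in> sets (word_space k)" by (simp add: sets_alternate_measure)
    have "space (alternate_measure k) = streams (letters k)"
      using sets_eq_imp_space_eq[OF sets_alternate_measure] by (simp add: space_word_space)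
    then have "emeasure (distr (alternate_measure k) (alternate_measure k) stl) B =
        emeasure (alternate_measure k) (stl -` B \<inter> streams (letters k))"
      using B by (subst emeasure_distr[OF stl_measurable]) (simp_all add: sets_alternate_measure)
    also have "\<dots> = emeasure (alternate_measure k) B"
      unfolding emeasure_alternate_measure[OF stl_vimage[OF B]] emeasure_alternate_measure[OF B]
        alternate_prob_stl[OF B] by (simp add: add.commute)
    finally show "emeasure (distr (alternate_measure k) (alternate_measure k) stl) B = emeasure (alternate_measure k) B" .
  qed simp
qed (rule stl_measurable)

lemma alternate_measure_ergodic: "shift_ergodic (alternate_measure k)"
  unfolding shift_ergodic_def
proof (intro ballI impI)
  interpret prob_space "alternate_measure k" by (rule prob_space_alternate_measure)
  have sp: "space (alternate_measure k) = streams (letters k)"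
    using sets_eq_imp_space_eq[OF sets_alternate_measure] by (simp add: space_word_space)
  fix E assume "E \<in> sets (alternate_measure k)" and inv: "stl -` E \<inter> space (alternate_measure k) = E"
  then have E: "E \<in> sets (word_space k)" by (simp add: sets_alternate_measure)
  have inv': "stl -` E \<inter> streams (letters k) = E" using inv by (simp add: sp)
  have inv'': "stl \<xi> \<in> E \<longleftrightarrow> \<xi> \<in> E" if "\<xi> \<in> streams (letters k)" for \<xi>
    using inv' that by blast
  \<comment> \<open>An invariant event has the same probability for either first factor, because the
    shift exchanges them.\<close>
  define q where "q = alternate_prob k FacA E"
  have "alternate_prob k FacB E = q"
    using alternate_prob_stl[OF E, of FacB] by (simp add: inv' q_def)
  then have q: "alternate_prob k f E = q" for f by (cases f) (simp_all add: q_def)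
  have Eq: "emeasure (alternate_measure k) E = q"
    using emeasure_alternate_measure[OF E] by (simp add: q mult_2_right[symmetric] ennreal_mult_divide_eq)
  have indep: "emeasure (alternate_measure k) (E \<inter> sstart (letters k) u) =
      q * emeasure (alternate_measure k) (sstart (letters k) u)" if u: "u \<in> lists (letters k)" "u \<noteq> []" for u
  proof -
    have m: "E \<inter> sstart (letters k) u \<in> sets (word_space k)"
      using E sstart_in_word_space[OF k u(1)] by (rule sets.Int)
    have "fst (hd u) = FacA \<or> fst (hd u) = FacB" by (cases "fst (hd u)") auto
    moreover have "alternate_prob k f (E \<inter> sstart (letters k) u) =
        (if u \<in> reduced_words k \<and> (u = [] \<or> fst (hd u) = f) then q * ennreal (word_weight k u) else 0)" for f
      using inv'' by (intro alternate_prob_cylinder E q u(1)) simp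
    ultimately show ?thesis
      unfolding emeasure_alternate_measure[OF m] emeasure_alternate_cylinder[OF u]
      using word_weight_bounds[OF k, of u] u(2)
      by (auto simp: ennreal_divide_numeral[symmetric] ennreal_times_divide)
  qed
  show "prob E = 0 \<or> prob E = 1"
  proof (cases "q = 0")
    case True
    then show ?thesis using Eq by (simp add: emeasure_eq_measure)
  next
    case False
    have qf: "q \<noteq> \<infinity>" using Eq emeasure_finite[of E] by simp
    \<comment> \<open>Independence from all cylinders makes the law conditioned on \<open>E\<close>
      equal to the law itself; evaluating both at \<open>E\<close> gives probability one.\<close>
    have "uniform_measure (alternate_measure k) E = alternate_measure k"
    proof (rule stream_measure_eqI_sstart[of "letters k"])
      show "prob_space (uniform_measure (alternate_measure k) E)"
        using False qf by (intro prob_space_uniform_measure) (simp_all add: Eq)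
      show "emeasure (uniform_measure (alternate_measure k) E) (sstart (letters k) u) =
          emeasure (alternate_measure k) (sstart (letters k) u)"
        if u: "u \<in> lists (letters k)" "u \<noteq> []" for u
        using E sstart_in_word_space[OF k u(1)] False qf
        by (subst emeasure_uniform_measure)
          (simp_all add: sets_alternate_measure indep[OF u] Eq ennreal_mult_divide_eq mult.commute[of q])
    qed (simp_all add: prob_space_alternate_measure sets_alternate_measure word_space_def)
    then have "emeasure (alternate_measure k) E = emeasure (uniform_measure (alternate_measure k) E) E" by simp
    also have "\<dots> = q / q"
      using E by (subst emeasure_uniform_measure) (simp_all add: sets_alternate_measure Eq)
    also have "\<dots> = 1" using False qf by (simp add: top.not_eq_extremum)
    finally show ?thesis by (simp add: emeasure_eq_measure)
  qed
qed

lemma prod_nth_conv_word_weight: "(\<Prod>i<length u. weight k (snd (u ! i))) = word_weight k u"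
  by (simp add: word_weight_def prod.list_conv_set_nth atLeast0LessThan)

lemma alternate_measure_markovian:
  "is_markovian_multiplicative k (\<lambda>(f, i). F i (root_F k) / 2) (alternate_measure k)"
proof -
  define r :: "letter \<Rightarrow> real" where "r = (\<lambda>(f, i). F i (root_F k) / 2)"
  have r: "r u = weight k (snd u) / 2" for u by (cases u) (simp add: r_def weight_def)
  have half: "sum r (letters_of k f) = 1 / 2" for f
  proof -
    have "sum r (letters_of k f) = (\<Sum>i=1..<k. weight k i / 2)"
      unfolding letters_of_def by (rule sum.reindex_bij_witness[of _ "\<lambda>i. (f, i)" snd]) (auto simp: r)
    also have "\<dots> = 1 / 2" using sum_weight[OF k] by (simp add: sum_divide_distrib[symmetric])
    finally show ?thesis .
  qed
  have fin: "finite (letters_of k f)" for f by (simp add: letters_of_def)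
  have disj: "letters_of k FacA \<inter> letters_of k FacB = {}" by (auto simp: letters_of_def)
  have "letters k - letters_of k f = letters_of k (other f)" for f
    using disj by (cases f) (auto simp: letters_def)
  \<comment> \<open>Each factor carries mass \<open>1/2\<close>, so every transition quotient is the
    weight of an exponent and a single \<open>1/2\<close> survives at the last letter.\<close>
  then have compl: "sum r (letters k - letters_of k f) = 1 / 2" for f by (simp add: half)
  have total: "sum r (letters k) = 1"
    unfolding letters_def using fin disj by (subst sum.union_disjoint) (simp_all add: half)
  have weight: "multiplicative_weight k r u = word_weight k u / 2" if ne: "u \<noteq> []" for u
  proof -
    obtain us x where u: "u = us @ [x]" using ne by (cases u rule: rev_cases) auto
    have "(\<Prod>i<length us. r (u ! i) / (1 / 2)) = (\<Prod>i<length us. weight k (snd (us ! i)))"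
      by (rule prod.cong) (auto simp: u r nth_append)
    then show ?thesis
      unfolding multiplicative_weight_def compl
      by (simp add: u prod_nth_conv_word_weight) (simp add: r word_weight_def)
  qed
  have "measure (alternate_measure k) (sstart (letters k) u) = word_weight k u / 2"
    if "u \<in> reduced_words k" "u \<noteq> []" for u
  proof -
    have "u \<in> lists (letters k)" using that by (simp add: reduced_words_def)
    then show ?thesis
      using emeasure_alternate_cylinder[of u] that word_weight_bounds[OF k that(1)] by (simp add: measure_def)
  qed
  then have "\<forall>u\<in>reduced_words k. u \<noteq> [] \<longrightarrow>
      measure (alternate_measure k) (sstart (letters k) u) = multiplicative_weight k r u"
    using weight by metis
  moreover have "\<forall>u\<in>letters k. 0 < r u" using weight_pos[OF k] by (simp add: r)
  ultimately show ?thesis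
    unfolding is_markovian_multiplicative_def r_def[symmetric]
    using total prob_space_alternate_measure sets_alternate_measure by blast
qed

lemma foldl_add_conv_sum: "foldl (\<lambda>S i. S + c i) 0 (stake n s) = (\<Sum>j<n. c (s !! j) :: nat)"
  by (induction n) (auto simp: stake_Suc simp del: stake.simps(2))

lemma AE_exponent_average:
  "AE s in exponent_space k. (\<lambda>n. potential k (stake n (alternate k f s)) / real n) \<longlonglongrightarrow> (real k - 2) / (1 - root_F k)"
proof -
  define d where "d = (real k - 2) / (1 - root_F k)"
  have mean: "measure_pmf.expectation (exponent_pmf k) (\<lambda>i. real (S + i * (k - i))) = real S + d" for S
  proof -
    have "measure_pmf.expectation (exponent_pmf k) (\<lambda>i. real (S + i * (k - i))) =
        (\<Sum>i\<in>{1..<k}. pmf (exponent_pmf k) i *\<^sub>R real (S + i * (k - i)))"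
      by (rule integral_measure_pmf) (simp_all add: set_exponent_pmf)
    also have "\<dots> = (\<Sum>i=1..<k. weight k i * real S + real (i * (k - i)) * weight k i)"
      by (rule sum.cong) (auto simp: pmf_exponent distrib_left mult.commute simp del: of_nat_mult)
    also have "\<dots> = real S + d"
      using sum_weighted_F_root[OF k] sum_weight[OF k]
      by (simp add: sum.distrib sum_distrib_right[symmetric] weight_def d_def del: of_nat_mult)
    finally show ?thesis .
  qed
  have "AE s in exponent_space k.
      (\<lambda>n. real (foldl (\<lambda>S i. S + i * (k - i)) 0 (stake n s)) / real n) \<longlonglongrightarrow> d"
  proof (rule strong_law_bounded_increments[where S=UNIV and K="real (k * k) + \<bar>d\<bar>"])
    fix S i assume "i \<in> set_pmf (exponent_pmf k)"
    then have "i * (k - i) \<le> k * k" by (intro mult_le_mono) (auto simp: set_exponent_pmf)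
    then have "real (i * (k - i)) \<le> real (k * k)" by (rule of_nat_mono)
    moreover have "0 \<le> real (i * (k - i))" by simp
    ultimately show "\<bar>real (S + i * (k - i)) - real S - d\<bar> \<le> real (k * k) + \<bar>d\<bar>"
      unfolding of_nat_add by linarith
  qed (use mean k in \<open>auto intro!: add_pos_nonneg\<close>)
  moreover have "AE s in exponent_space k. stream_all (\<lambda>i. i \<in> set_pmf (exponent_pmf k)) s"
    by (rule prob_space.AE_stream_all[OF prob_space_measure_pmf]) (auto simp: AE_measure_pmf_iff)
  ultimately show ?thesis
  proof eventually_elim
    case (elim s)
    \<comment> \<open>Almost surely all exponents lie in the support, where clamping changes
      nothing.\<close>
    then have "clamp_exponent k (s !! j) = s !! j" for j
      by (simp add: clamp_exponent_def set_exponent_pmf)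
    then have "potential k (stake n (alternate k f s)) = real (foldl (\<lambda>S i. S + i * (k - i)) 0 (stake n s))" for n
      unfolding potential_stake foldl_add_conv_sum by (simp add: alternate_snth)
    then show ?case using elim(1) by (simp add: d_def)
  qed
qed

text \<open>The average is known for i.i.d. exponents and passes to the limit word by equality of
  laws, provided the exceptional set is an event of \<open>word_space\<close>.\<close>

lemma AE_limit_average:
  "AE \<omega> in step_space (simple_step k).
    (\<lambda>n. potential k (stake n (limit_end k \<omega>)) / real n) \<longlonglongrightarrow> (real k - 2) / (1 - root_F k)"
proof -
  define d where "d = (real k - 2) / (1 - root_F k)"
  define g where "g n \<xi> = potential k (stake n \<xi>) / real n" for n \<xi>
  \<comment> \<open>Convergence in countable quantifiers, which makes \<open>Bad\<close>
    measurable.\<close>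
  have conv: "(\<lambda>n. g n \<xi>) \<longlonglongrightarrow> d \<longleftrightarrow> (\<forall>j. \<exists>N. \<forall>n\<ge>N. \<bar>g n \<xi> - d\<bar> < 1 / real (Suc j))" for \<xi>
  proof
    assume "(\<lambda>n. g n \<xi>) \<longlonglongrightarrow> d"
    from LIMSEQ_D[OF this] show "\<forall>j. \<exists>N. \<forall>n\<ge>N. \<bar>g n \<xi> - d\<bar> < 1 / real (Suc j)" by simp
  next
    assume a: "\<forall>j. \<exists>N. \<forall>n\<ge>N. \<bar>g n \<xi> - d\<bar> < 1 / real (Suc j)"
    show "(\<lambda>n. g n \<xi>) \<longlonglongrightarrow> d"
    proof (rule LIMSEQ_I)
      fix e :: real assume "0 < e"
      then obtain j where "1 / real (Suc j) < e" using nat_approx_posE by blast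
      then show "\<exists>N. \<forall>n\<ge>N. norm (g n \<xi> - d) < e"
        using a[rule_format, of j] by (auto intro: less_trans)
    qed
  qed
  have [measurable]: "g n \<in> borel_measurable (word_space k)" for n
  proof -
    have "(\<lambda>\<xi>. real (snd (\<xi> !! j) * (k - snd (\<xi> !! j)))) \<in> borel_measurable (word_space k)" for j
      unfolding word_space_def
      by (rule measurable_compose[OF measurable_snth[of j "count_space (letters k)"]]) simp
    then show ?thesis unfolding g_def potential_stake by measurable
  qed
  define Bad where "Bad = {\<xi> \<in> space (word_space k). \<not> (\<forall>j. \<exists>N. \<forall>n\<ge>N. \<bar>g n \<xi> - d\<bar> < 1 / real (Suc j))}"
  have Bad: "Bad \<in> sets (word_space k)" unfolding Bad_def by measurable
  have Bad_iff: "\<xi> \<in> Bad \<longleftrightarrow> \<xi> \<in> space (word_space k) \<and> \<not> (\<lambda>n. g n \<xi>) \<longlonglongrightarrow> d" for \<xi>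
    unfolding Bad_def conv by simp
  have "alternate_prob k f Bad = 0" for f
  proof -
    have "AE s in exponent_space k. \<not> alternate k f s \<in> Bad"
      using AE_exponent_average[of f]
      by eventually_elim (simp add: Bad_iff d_def g_def)
    then have "emeasure (exponent_space k) {s \<in> space (exponent_space k). alternate k f s \<in> Bad} = 0"
      by (rule emeasure_eq_0_AE)
    then show ?thesis by (simp add: alternate_prob_def)
  qed
  then have "emeasure (harmonic_measure k (simple_step k)) Bad = 0"
    by (simp add: harmonic_measure_alternate emeasure_alternate_measure[OF Bad])
  then have "emeasure (step_space (simple_step k)) (limit_end k -` Bad \<inter> space (step_space (simple_step k))) = 0"
    unfolding harmonic_measure_eq[OF k]
    using k by (subst (asm) emeasure_distr[OF limit_end_measurable Bad]) auto
  then have "AE \<omega> in step_space (simple_step k). \<omega> \<notin> limit_end k -` Bad \<inter> space (step_space (simple_step k))"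
    using k by (intro AE_not_in null_setsI measurable_sets[OF limit_end_measurable Bad]) auto
  then show ?thesis
    using AE_space
    by eventually_elim
      (auto simp: Bad_iff d_def g_def space_word_space limit_end_in_streams[OF k])
qed

end

section \<open>The drift\<close>

context
  fixes k :: nat
  assumes k: "3 \<le> k"
begin

lemma walk_length_diff:
  assumes "admissible k \<omega>" "n \<le> m"
  shows "length (walk k \<omega> n) \<le> length (walk k \<omega> m) + (m - n)"
  using assms(2)
proof (induction m rule: dec_induct)
  case (step m)
  then show ?case
    using walk_Suc_length(2)[OF k assms(1), of m] by (simp del: walk.simps)
qed simp

text \<open>A pathwise argument. After time \<open>n\<close> the length never drops below its value
  at \<open>M n\<close>, so a prefix of the limit word is already in place at time \<open>n\<close>.
  Linear growth of the potential forces \<open>M n\<close> close to \<open>n\<close>; hence the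
  prefix misses only \<open>o(n)\<close> letters, and its potential converts into letters at the
  rate \<open>c\<close>.\<close>

lemma walk_length_rate:
  assumes adm: "admissible k \<omega>"
    and pot: "(\<lambda>n. potential k (walk k \<omega> n) / real n) \<longlonglongrightarrow> \<delta>" "0 < \<delta>"
    and len: "filterlim (\<lambda>n. length (walk k \<omega> n)) at_top sequentially"
    and avg: "(\<lambda>n. potential k (stake n (limit_end k \<omega>)) / real n) \<longlonglongrightarrow> c" "0 < c"
  shows "(\<lambda>n. real (length (walk k \<omega> n)) / real n) \<longlonglongrightarrow> \<delta> / c"
proof -
  define l where "l n = length (walk k \<omega> n)" for n
  define \<phi> where "\<phi> n = potential k (walk k \<omega> n)" for n
  define \<psi> where "\<psi> n = potential k (stake n (limit_end k \<omega>))" for n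
  \<comment> \<open>A time of minimal length among all times from \<open>n\<close> on.\<close>
  have "\<forall>n. \<exists>m. n \<le> m \<and> (\<forall>j. n \<le> j \<longrightarrow> l m \<le> l j)"
    using ex_has_least_nat[of "\<lambda>m. _ \<le> m" _ l] by blast
  then obtain M where M: "\<And>n. n \<le> M n" "\<And>n j. n \<le> j \<Longrightarrow> l (M n) \<le> l j" by metis
  \<comment> \<open>One less than the minimum, because a last letter may still change its exponent.
    If the minimum is positive, the first \<open>L n\<close> letters are final from time
    \<open>n\<close> on.\<close>
  define L where "L n = l (M n) - 1" for n
  have M_top: "filterlim M at_top sequentially"
    using M(1) by (intro filterlim_at_top_mono[OF filterlim_ident]) auto
  have lM_top: "filterlim (\<lambda>n. l (M n)) at_top sequentially"
    using filterlim_compose[OF len M_top] by (simp add: l_def)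
  have L_top: "filterlim L at_top sequentially"
    unfolding L_def by (rule filterlim_compose[OF filterlim_minus_const_nat_at_top lM_top])
  have split: "\<exists>t \<in> reduced_words k. walk k \<omega> j = stake (L n) (limit_end k \<omega>) @ t \<and> length t = l j - L n"
    if "n \<le> j" "1 \<le> l (M n)" for n j
  proof -
    have "take (L n) (walk k \<omega> j) = stake (L n) (limit_end k \<omega>)"
    proof (rule limit_end_prefix[OF k adm])
      fix i assume "j \<le> i"
      then show "L n < length (walk k \<omega> i)"
        using that M(2)[of n i] by (auto simp: L_def l_def)
    qed
    then have e: "walk k \<omega> j = stake (L n) (limit_end k \<omega>) @ drop (L n) (walk k \<omega> j)"
      by (metis append_take_drop_id)
    have "drop (L n) (walk k \<omega> j) \<in> reduced_words k"
      using walk_reduced[OF k adm, of j] by (subst (asm) e) (auto simp: reduced_words_def successively_append_iff)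
    then show ?thesis using e by (intro bexI[of _ "drop (L n) (walk k \<omega> j)"]) (simp_all add: l_def)
  qed
  have ev: "\<forall>\<^sub>F n in sequentially. 0 < n \<and> 1 \<le> l (M n) \<and> 0 < \<phi> (M n) / M n \<and> 0 < L n \<and> 0 < \<psi> (L n) / L n"
  proof (intro eventually_conj)
    show "\<forall>\<^sub>F n in sequentially. 0 < \<phi> (M n) / M n"
      using filterlim_compose[OF pot(1) M_top] pot(2) unfolding \<phi>_def by (rule order_tendstoD)
    show "\<forall>\<^sub>F n in sequentially. 0 < \<psi> (L n) / L n"
      using filterlim_compose[OF avg(1) L_top] avg(2) unfolding \<psi>_def by (rule order_tendstoD)
    show "\<forall>\<^sub>F n in sequentially. 1 \<le> l (M n)"
      using lM_top by (simp only: filterlim_at_top)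
    show "\<forall>\<^sub>F n in sequentially. 0 < L n"
      using L_top eventually_gt_at_top[of 0] by (auto simp: filterlim_iff)
  qed (rule eventually_gt_at_top)
  \<comment> \<open>At time \<open>M n\<close> the walk is the settled prefix and one more letter,
    of weight at most \<open>k * k\<close>, while at time \<open>n\<close> it already contains that
    prefix.\<close>
  have M_bound: "\<phi> (M n) \<le> \<phi> n + real (k * k)"
    and \<psi>_upper: "\<psi> (L n) \<le> \<phi> n"
    and \<psi>_lower: "\<phi> n \<le> \<psi> (L n) + real (k * k) * real (l n - L n)"
    and lL: "l n - L n \<le> M n - n + 1" "L n \<le> l n" if n: "1 \<le> l (M n)" for n
  proof -
    obtain t where t: "t \<in> reduced_words k" "walk k \<omega> n = stake (L n) (limit_end k \<omega>) @ t" "length t = l n - L n"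
      using split[of n n] n by auto
    obtain s where s: "s \<in> reduced_words k" "walk k \<omega> (M n) = stake (L n) (limit_end k \<omega>) @ s" "length s = l (M n) - L n"
      using split[of n "M n"] n M(1) by auto
    have "length s = 1" using s(3) n by (simp add: L_def)
    then have "\<phi> (M n) \<le> \<psi> (L n) + real (k * k)"
      using potential_bounds(2)[OF k s(1)] by (simp add: \<phi>_def \<psi>_def s(2) potential_append del: of_nat_mult)
    moreover show up: "\<psi> (L n) \<le> \<phi> n"
      using potential_bounds(1)[OF k t(1)] by (simp add: \<phi>_def \<psi>_def t(2) potential_append)
    ultimately show "\<phi> (M n) \<le> \<phi> n + real (k * k)" by linarith
    show "\<phi> n \<le> \<psi> (L n) + real (k * k) * real (l n - L n)"
      using potential_bounds(2)[OF k t(1)] by (simp add: \<phi>_def \<psi>_def t(2,3) potential_append del: of_nat_mult of_nat_diff)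
    have "l n \<le> l (M n) + (M n - n)" using walk_length_diff[OF adm M(1)[of n]] by (simp add: l_def)
    then show "l n - L n \<le> M n - n + 1" using n by (simp add: L_def)
    show "L n \<le> l n" using M(2)[of n n] by (simp add: L_def)
  qed
  \<comment> \<open>By \<open>M_bound\<close> the potential at \<open>M n\<close> hardly exceeds the
    one at \<open>n\<close>, although it grows at the positive rate \<open>\<delta>\<close>; so the
    two times are asymptotically equal.\<close>
  have M_rate: "(\<lambda>n. real (M n) / real n) \<longlonglongrightarrow> 1"
  proof (rule tendsto_sandwich[OF _ _ tendsto_const])
    show "\<forall>\<^sub>F n in sequentially. 1 \<le> real (M n) / real n"
      using eventually_gt_at_top[of 0] by eventually_elim (use M(1) in \<open>simp add: divide_simps\<close>)
    show "\<forall>\<^sub>F n in sequentially. real (M n) / real n \<le> (\<phi> n / real n + real (k * k) / real n) / (\<phi> (M n) / real (M n))"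
      using ev
    proof eventually_elim
      case (elim n)
      then have "0 < M n" "0 < \<phi> (M n)" using M(1)[of n] by (auto simp: zero_less_divide_iff)
      then have "real (M n) / real n = (\<phi> (M n) / real n) / (\<phi> (M n) / real (M n))"
        by simp
      also have "\<dots> \<le> ((\<phi> n + real (k * k)) / real n) / (\<phi> (M n) / real (M n))"
        using elim M_bound[of n] by (intro divide_right_mono) auto
      finally show ?case by (simp add: add_divide_distrib)
    qed
    have "(\<lambda>n. (\<phi> n / real n + real (k * k) / real n) / (\<phi> (M n) / real (M n))) \<longlonglongrightarrow> (\<delta> + 0) / \<delta>"
      using pot filterlim_compose[OF pot(1) M_top]
      by (intro tendsto_intros lim_const_over_n) (auto simp: \<phi>_def)
    then show "(\<lambda>n. (\<phi> n / real n + real (k * k) / real n) / (\<phi> (M n) / real (M n))) \<longlonglongrightarrow> 1"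
      using pot(2) by simp
  qed
  have gap: "(\<lambda>n. real (l n - L n) / real n) \<longlonglongrightarrow> 0"
  proof (rule tendsto_sandwich[OF _ _ tendsto_const])
    show "\<forall>\<^sub>F n in sequentially. real (l n - L n) / real n \<le> real (M n) / real n - 1 + 1 / real n"
      using ev
    proof eventually_elim
      case (elim n)
      then have "real (l n - L n) \<le> real (M n) - real n + 1"
        using lL(1)[of n] M(1)[of n] by linarith
      then have "real (l n - L n) / real n \<le> (real (M n) - real n + 1) / real n"
        by (rule divide_right_mono) simp
      then show ?case using elim by (simp add: add_divide_distrib diff_divide_distrib)
    qed
    have "(\<lambda>n. real (M n) / real n - 1 + 1 / real n) \<longlonglongrightarrow> 1 - 1 + 0"
      by (intro tendsto_intros M_rate lim_const_over_n)
    then show "(\<lambda>n. real (M n) / real n - 1 + 1 / real n) \<longlonglongrightarrow> 0" by simp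
  qed simp
  have \<psi>_rate: "(\<lambda>n. \<psi> (L n) / real n) \<longlonglongrightarrow> \<delta>"
  proof (rule tendsto_sandwich)
    show "\<forall>\<^sub>F n in sequentially. \<psi> (L n) / real n \<le> \<phi> n / real n"
      using ev by eventually_elim (use \<psi>_upper in \<open>auto intro!: divide_right_mono\<close>)
    show "\<forall>\<^sub>F n in sequentially. \<phi> n / real n - real (k * k) * (real (l n - L n) / real n) \<le> \<psi> (L n) / real n"
      using ev
    proof eventually_elim
      case (elim n)
      then have "(\<phi> n - real (k * k) * real (l n - L n)) / real n \<le> \<psi> (L n) / real n"
        using \<psi>_lower[of n] by (intro divide_right_mono) auto
      then show ?case by (simp add: diff_divide_distrib)
    qed
    have "(\<lambda>n. \<phi> n / real n - real (k * k) * (real (l n - L n) / real n)) \<longlonglongrightarrow> \<delta> - real (k * k) * 0"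
      unfolding \<phi>_def by (intro tendsto_intros gap pot)
    then show "(\<lambda>n. \<phi> n / real n - real (k * k) * (real (l n - L n) / real n)) \<longlonglongrightarrow> \<delta>" by simp
  qed (use pot(1) in \<open>simp add: \<phi>_def\<close>)
  \<comment> \<open>Potential per unit of time divided by potential per letter is
    \<open>L n / n\<close>; the gap restores the full length.\<close>
  have "(\<lambda>n. (\<psi> (L n) / real n) / (\<psi> (L n) / real (L n)) + real (l n - L n) / real n) \<longlonglongrightarrow> \<delta> / c + 0"
    using avg filterlim_compose[OF avg(1) L_top]
    by (intro tendsto_intros \<psi>_rate gap) (auto simp: \<psi>_def)
  moreover have "\<forall>\<^sub>F n in sequentially.
      (\<psi> (L n) / real n) / (\<psi> (L n) / real (L n)) + real (l n - L n) / real n = real (l n) / real n"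
    using ev
  proof eventually_elim
    case (elim n)
    then have "0 < \<psi> (L n)" by (auto simp: zero_less_divide_iff)
    then have "(\<psi> (L n) / real n) / (\<psi> (L n) / real (L n)) = real (L n) / real n" by simp
    then show ?case using lL(2)[of n] elim by (simp add: add_divide_distrib[symmetric])
  qed
  ultimately show ?thesis by (simp add: tendsto_cong l_def)
qed

lemma has_drift_iff: "has_drift k (simple_step k) \<gamma> \<longleftrightarrow> \<gamma> = (1 - root_F k) / 2"
proof -
  interpret prob_space "step_space (simple_step k)"
    unfolding step_space_def by (rule prob_space_stream_pmf)
  have pos: "0 < (real k - 2) / 2" "0 < (real k - 2) / (1 - root_F k)"
    using k root_F[OF k] by auto
  have e: "(real k - 2) / 2 / ((real k - 2) / (1 - root_F k)) = (1 - root_F k) / 2"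
  proof -
    have "a / 2 / (a / b) = b / 2" if "a \<noteq> 0" for a b :: real using that by simp
    from this[of "real k - 2"] show ?thesis using k by simp
  qed
  have drift: "AE \<omega> in step_space (simple_step k).
      (\<lambda>n. real (length (walk k \<omega> n)) / real n) \<longlonglongrightarrow> (1 - root_F k) / 2"
    using AE_admissible[OF k] AE_potential_rate[OF k] AE_length_at_top[OF k] AE_limit_average[OF k]
  proof eventually_elim
    case (elim \<omega>)
    from walk_length_rate[OF elim(1,2) pos(1) elim(3,4) pos(2)] show ?case unfolding e .
  qed
  show ?thesis
  proof
    assume "has_drift k (simple_step k) \<gamma>"
    then have "AE \<omega> in step_space (simple_step k). \<gamma> = (1 - root_F k) / 2"
      unfolding has_drift_def using drift by eventually_elim (rule LIMSEQ_unique)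
    then show "\<gamma> = (1 - root_F k) / 2" by simp
  next
    assume "\<gamma> = (1 - root_F k) / 2"
    then show "has_drift k (simple_step k) \<gamma>" using drift by (simp only: has_drift_def)
  qed
qed

lemma drift_eq: "drift k (simple_step k) = (1 - root_F k) / 2"
  unfolding drift_def has_drift_iff by (rule the_eq_trivial)

lemma root_F_less:
  assumes "k < l"
  shows "root_F l < root_F k"
proof -
  from assms have "Suc k \<le> l" by simp
  then show ?thesis
  proof (induction l rule: dec_induct)
    case (step l)
    then show ?case using root_F_Suc_less[of l] k by simp
  qed (rule root_F_Suc_less[OF k])
qed

end

theorem theorem4p2:
  shows "(\<forall>k::nat\<ge>3.
      (\<exists>!x. x \<in> {0<..<1} \<and> F k x = 1) \<and>
      is_harmonic_measure k (simple_step k) (harmonic_measure k (simple_step k)) \<and>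
      shift_stationary (harmonic_measure k (simple_step k)) \<and>
      shift_ergodic (harmonic_measure k (simple_step k)) \<and>
      is_markovian_multiplicative k (\<lambda>(f, i). F i (root_F k) / 2)
        (harmonic_measure k (simple_step k)) \<and>
      (\<forall>i\<in>{1..k - 1}. F i (root_F k) = F (k - i) (root_F k)) \<and>
      has_drift k (simple_step k) (drift k (simple_step k)) \<and>
      drift k (simple_step k) = (1 - root_F k) / 2) \<and>
    strict_mono_on {3..} (\<lambda>k. drift k (simple_step k)) \<and>
    (\<lambda>k. drift k (simple_step k)) \<longlonglongrightarrow> 1 / 3"
proof (intro conjI allI impI)
  fix k :: nat assume k: "3 \<le> k"
  show "\<exists>!x. x \<in> {0<..<1} \<and> F k x = 1" by (rule F_root_ex1[OF k])
  show "is_harmonic_measure k (simple_step k) (harmonic_measure k (simple_step k))"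
    unfolding is_harmonic_measure_iff[OF k] by (rule harmonic_measure_eq[OF k])
  show "shift_stationary (harmonic_measure k (simple_step k))"
    "shift_ergodic (harmonic_measure k (simple_step k))"
    "is_markovian_multiplicative k (\<lambda>(f, i). F i (root_F k) / 2) (harmonic_measure k (simple_step k))"
    unfolding harmonic_measure_alternate[OF k]
    using alternate_measure_stationary alternate_measure_ergodic alternate_measure_markovian k by auto
  show "\<forall>i\<in>{1..k - 1}. F i (root_F k) = F (k - i) (root_F k)"
  proof
    fix i assume "i \<in> {1..k - 1}"
    then have "i \<le> k" unfolding atLeastAtMost_iff by arith
    from F_root_symmetric[OF k this] show "F i (root_F k) = F (k - i) (root_F k)" by simp
  qed
  show "drift k (simple_step k) = (1 - root_F k) / 2" by (rule drift_eq[OF k])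
  then show "has_drift k (simple_step k) (drift k (simple_step k))"
    by (simp add: has_drift_iff[OF k])
next
  show "strict_mono_on {3..} (\<lambda>k. drift k (simple_step k))"
    by (rule strict_mono_onI) (simp add: drift_eq root_F_less)
  have "(\<lambda>k. (1 - root_F k) / 2) \<longlonglongrightarrow> (1 - 1 / 3) / 2"
    by (intro tendsto_intros root_F_tendsto) simp
  moreover have "\<forall>\<^sub>F k in sequentially. (1 - root_F k) / 2 = drift k (simple_step k)"
    using eventually_ge_at_top[of 3] by eventually_elim (simp add: drift_eq)
  ultimately show "(\<lambda>k. drift k (simple_step k)) \<longlonglongrightarrow> 1 / 3"
    by (simp add: tendsto_cong)
qed

end
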